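(* Let $q\ge 1$, let $U$ be a compact subset of $V$, and for $T>0$ let $\mathcal U_{ad}=\{f\in L^q(0,T;V): f(s)\in U \text{ for a.e. } s\in[0,T]\}$. Assume: (a) for each $N\ge1$ the linear flow $e^{L_N t}:\mathcal H_N\to\mathcal H_N$ extends to a $C_0$-semigroup $T_N(t)$ on $\mathcal H$, and $\|T_N(t)\|\le M e^{\omega t}$ for all $N\ge 1$, $t\ge0$; (b) $\lim_{N\to\infty}\|L_N\phi-L\phi\|_{\mathcal H}=0$ for all $\phi\in D(L)$; (c) $F:\mathcal H\to\mathcal H$ is locally Lipschitz; (d) for each $T>0$ and $(x,u)\in\mathcal H\times\mathcal U_{ad}$, the state equation admits a unique mild solution $y(\cdot;x,u)\in C([0,T],\mathcal H)$ and, for each $N\ge1$, its Galerkin approximation admits a unique solution $y_N(\cdot;\Pi_N x,u)\in C([0,T],\mathcal H)$; moreover there is a constant $\mathcal C=\mathcal C(T,x)$ such that $\|y(t;x,u)\|_{\mathcal H}\le\mathcal C$ and $\|y_N(t;\Pi_Nx,u)\|_{\mathcal H}\le\mathcal C$ for all $t\in[0,T]$, $N\ge1$, $u\in\mathcal U_{ad}$; (e) for each $T>0$ and $x\in\mathcal H$, $\lim_{N\to\infty}\sup_{u\in\mathcal U_{ad}}\sup_{t\in[0,T]}\|(\mathrm{Id}_{\mathcal H}-\Pi_N)y(t;x,u)\|_{\mathcal H}=0$; (f) $\mathfrak C:V\to\mathcal H$ is continuous. Then for every $T>0$ and $x\in\mathcal H$, with $x_N:=\Pi_Nx$, $$\lim_{N\to\infty}\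 \sup_{t\in[0,T]}\ \sup_{u\in\mathcal U_{ad}[t,T]}\ \sup_{s\in[t,T]}\|y^N_{t,x_N}(s;u)-y_{t,x}(s;u)\|_{\mathcal H}=0.$$
   Context: $\mathcal H$ and $V$ are separable Hilbert spaces; $F:\mathcal H\to\mathcal H$ and $\mathfrak C:V\to\mathcal H$ are (possibly nonlinear) maps, with $\mathfrak C(0)=0$. The operator $L:D(L)\subset\mathcal H\to\mathcal H$ is the infinitesimal generator of a $C_0$-semigroup $(T(t))_{t\ge0}$ of bounded linear operators on $\mathcal H$, and $M\ge1$, $\omega\ge0$ are constants with $\|T(t)\|\le Me^{\omega t}$ for $t\ge0$ ($\|\cdot\|$ is the operator norm). (The letter $T$ alone denotes the final time.) State equation: $\frac{dy}{dt}=Ly+F(y)+\mathfrak C(u(t))$ on $(0,T]$, $y(0)=x\in\mathcal H$. A mild solution over $[0,T]$ is $y\in C([0,T],\mathcal H)$ with $y(t)=T(t)x+\int_0^tT(t-s)F(y(s))\,ds+\int_0^tT(t-s)\mathfrak C(u(s))\,ds$ for $t\in[0,T]$; it is denoted $y(\cdot;x,u)$. Galerkin approximation: $(\mathcal H_N)_{N\ge1}$ is a sequence of finite-dimensional subspaces of $\mathcal H$ with $\mathcal H_N\subset D(L)$, $\Pi_N:\mathcal H\to\mathcal H_N$ is the orthogonal projector, and $\|(\Pi_N-\mathrm{Id})x\|_{\mathcal H}\to0$ as $N\to\infty$ for all $x\in\mathcal H$. Put $L_N:=\Pi_NL\Pi_N:\mathcal H\to\mathcal H_N$. The Galerkin approximation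 is $\frac{dy_N}{dt}=L_Ny_N+\Pi_NF(y_N)+\Pi_N\mathfrak C(u(t))$ on $[0,T]$, $y_N(0)=\Pi_Nx$, understood through the variation-of-constants formula $y_N(t)=e^{L_Nt}\Pi_Nx+\int_0^te^{L_N(t-s)}\Pi_NF(y_N(s))\,ds+\int_0^te^{L_N(t-s)}\Pi_N\mathfrak C(u(s))\,ds$; its solution is denoted $y_N(\cdot;\Pi_Nx,u)$. Problems started at time $t$: for $t\in[0,T)$ put $\mathcal U_{ad}[t,T]:=\{u|_{[t,T]}:u\in\mathcal U_{ad}\}$. For $u\in\mathcal U_{ad}[t,T]$, $y_{t,x}(\cdot;u)$ denotes the mild solution over $[t,T]$ of $\frac{dy}{ds}=Ly+F(y)+\mathfrak C(u(s))$, $s\in(t,T]$, $y(t)=x$, and $y^N_{t,x_N}(\cdot;u)$ denotes the solution of $\frac{dy_N}{ds}=L_Ny_N+\Pi_NF(y_N)+\Pi_N\mathfrak C(u(s))$, $s\in(t,T]$, $y_N(t)=x_N:=\Pi_Nx$. For $t=T$ these are read as $y_{T,x}(T;u)=x$ and $y^N_{T,x_N}(T;u)=x_N$. A map $f:\mathcal W_1\to\mathcal W_2$ between Banach spaces is locally Lipschitz if it is Lipschitz on every ball of $\mathcal W_1$ centered at the origin. *)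

theory Defs
  imports "HOL-Analysis.Analysis"
begin

definition c0_semigroup :: "(real \<Rightarrow> 'h \<Rightarrow>\<^sub>L 'h::real_normed_vector) \<Rightarrow> bool" where
  "c0_semigroup S \<longleftrightarrow>
     S 0 = id_blinfun \<and>
     (\<forall>s\<ge>0. \<forall>t\<ge>0. S (s + t) = S s o\<^sub>L S t) \<and>
     (\<forall>x. ((\<lambda>t. S t x) \<longlongrightarrow> x) (at_right 0))"

text \<open>An unbounded operator is a domain \<open>D\<close> together with a total function \<open>L\<close> whose values
  outside \<open>D\<close> are irrelevant.\<close>

definition is_generator ::
  "(real \<Rightarrow> 'h \<Rightarrow>\<^sub>L 'h::real_normed_vector) \<Rightarrow> 'h set \<Rightarrow> ('h \<Rightarrow> 'h) \<Rightarrow> bool" where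
  "is_generator S D L \<longleftrightarrow>
     D = {x. \<exists>z. ((\<lambda>h. (S h x - x) /\<^sub>R h) \<longlongrightarrow> z) (at_right 0)} \<and>
     (\<forall>x\<in>D. ((\<lambda>h. (S h x - x) /\<^sub>R h) \<longlongrightarrow> L x) (at_right 0))"

definition is_orthogonal_projector :: "'h::real_inner set \<Rightarrow> ('h \<Rightarrow> 'h) \<Rightarrow> bool" where
  "is_orthogonal_projector W P \<longleftrightarrow> (\<forall>x. P x \<in> W \<and> (\<forall>z\<in>W. inner (x - P x) z = 0))"

text \<open>The library's \<open>local_lipschitz\<close> asks for a Lipschitz bound near each point; here the bound
  is required on every ball around the origin, which is stronger in infinite dimensions.\<close>

definition lipschitz_on_balls :: "('a::real_normed_vector \<Rightarrow> 'b::real_normed_vector) \<Rightarrow> bool" where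
  "lipschitz_on_balls f \<longleftrightarrow> (\<forall>r>0. \<exists>K. K-lipschitz_on (ball 0 r) f)"

definition exp_flow :: "('h \<Rightarrow> 'h) \<Rightarrow> real \<Rightarrow> 'h \<Rightarrow> 'h::real_normed_vector" where
  "exp_flow A t x = (\<Sum>k. (t ^ k / fact k) *\<^sub>R (A ^^ k) x)"

definition galerkin_op :: "('h \<Rightarrow> 'h) \<Rightarrow> ('h \<Rightarrow> 'h) \<Rightarrow> 'h \<Rightarrow> 'h" where
  "galerkin_op P L x = P (L (P x))"

text \<open>Controls are represented by measurable functions rather than classes modulo null sets;
  the equations below only see a control under the integral sign. Values outside the
  time interval are unconstrained in \<open>admissible\<close> and cut off in \<open>admissible_from\<close>.\<close>

definition admissible ::
  "real \<Rightarrow> 'v::{real_normed_vector, second_countable_topology} set \<Rightarrow> real \<Rightarrow> (real \<Rightarrow> 'v) set" where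
  "admissible q U T =
     {u. u \<in> borel_measurable (lebesgue_on {0..T}) \<and>
         integrable (lebesgue_on {0..T}) (\<lambda>s. norm (u s) powr q) \<and>
         (AE s in lebesgue_on {0..T}. u s \<in> U)}"

definition admissible_from ::
  "real \<Rightarrow> 'v::{real_normed_vector, second_countable_topology} set \<Rightarrow> real \<Rightarrow> real \<Rightarrow> (real \<Rightarrow> 'v) set" where
  "admissible_from q U t T = (\<lambda>u. restrict u {t..T}) ` admissible q U T"

text \<open>\<open>E\<close> is the linear flow, \<open>G\<close> the nonlinearity, \<open>B\<close> the control map, and \<open>x\<close> the state at the
  initial time \<open>t\<close>. Elements of \<open>C([t,T])\<close> are represented by functions that are \<open>extensional\<close> on
  \<open>{t..T}\<close>, so that uniqueness can be expressed by plain equality. The formula also covers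
  the degenerate interval \<open>t = T\<close>; see \<open>voc_solution_degenerate\<close>.\<close>

definition voc_solution ::
  "(real \<Rightarrow> 'h \<Rightarrow> 'h::{banach, second_countable_topology}) \<Rightarrow> ('h \<Rightarrow> 'h) \<Rightarrow> ('v \<Rightarrow> 'h) \<Rightarrow>
   real \<Rightarrow> real \<Rightarrow> 'h \<Rightarrow> (real \<Rightarrow> 'v) \<Rightarrow> (real \<Rightarrow> 'h) \<Rightarrow> bool" where
  "voc_solution E G B t T x u y \<longleftrightarrow>
     y \<in> extensional {t..T} \<and> continuous_on {t..T} y \<and>
     (\<forall>s\<in>{t..T}.
        set_integrable lebesgue {t..s} (\<lambda>r. E (s - r) (G (y r))) \<and>
        set_integrable lebesgue {t..s} (\<lambda>r. E (s - r) (B (u r))) \<and>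
        y s = E (s - t) x
              + (LINT r:{t..s}|lebesgue. E (s - r) (G (y r)))
              + (LINT r:{t..s}|lebesgue. E (s - r) (B (u r))))"

lemma set_integral_singleton_lebesgue:
  fixes f :: "real \<Rightarrow> 'a::{banach, second_countable_topology}"
  shows "set_integrable lebesgue {t} f" and "(LINT r:{t}|lebesgue. f r) = 0"
proof -
  have n: "{t} \<in> null_sets lebesgue" by (simp add: null_sets_def)
  have ae: "AE r in lebesgue. indicator {t} r *\<^sub>R f r = 0"
    by (rule AE_I'[OF n]) (auto simp: indicator_def)
  have m: "(\<lambda>r. indicator {t} r *\<^sub>R f r) \<in> borel_measurable lebesgue"
    by (rule measurable_discrete_difference[where f="\<lambda>_. 0" and X="{t}"]) auto
  show "set_integrable lebesgue {t} f"
    unfolding set_integrable_def using integrable_cong_AE[OF m _ ae] by simp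
  show "(LINT r:{t}|lebesgue. f r) = 0"
    unfolding set_lebesgue_integral_def using integral_cong_AE[OF m _ ae] by simp
qed

lemma voc_solution_degenerate:
  "voc_solution E G B T T x u y \<longleftrightarrow> y \<in> extensional {T} \<and> y T = E 0 x"
  by (auto simp: voc_solution_def set_integral_singleton_lebesgue)

definition is_mild_solution ::
  "(real \<Rightarrow> 'h \<Rightarrow>\<^sub>L 'h::{banach, second_countable_topology}) \<Rightarrow> ('h \<Rightarrow> 'h) \<Rightarrow> ('v \<Rightarrow> 'h) \<Rightarrow>
   real \<Rightarrow> real \<Rightarrow> 'h \<Rightarrow> (real \<Rightarrow> 'v) \<Rightarrow> (real \<Rightarrow> 'h) \<Rightarrow> bool" where
  "is_mild_solution S F C t T x u =
     voc_solution (\<lambda>\<tau>. blinfun_apply (S \<tau>)) F C t T x u"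

definition is_galerkin_solution ::
  "('h \<Rightarrow> 'h) \<Rightarrow> ('h \<Rightarrow> 'h) \<Rightarrow> ('h \<Rightarrow> 'h) \<Rightarrow> ('v \<Rightarrow> 'h::{banach, second_countable_topology}) \<Rightarrow>
   real \<Rightarrow> real \<Rightarrow> 'h \<Rightarrow> (real \<Rightarrow> 'v) \<Rightarrow> (real \<Rightarrow> 'h) \<Rightarrow> bool" where
  "is_galerkin_solution P L F C t T x u =
     voc_solution (exp_flow (galerkin_op P L)) (\<lambda>z. P (F z)) (\<lambda>v. P (C v)) t T (P x) u"

text \<open>\<open>mild_sol S F C t T x u s\<close> is \<open>y\<^sub>t\<^sub>,\<^sub>x(s; u)\<close> on \<open>[t,T]\<close>, and \<open>galerkin_sol\<close> is its Galerkin
  counterpart started at \<open>P x\<close>. Both are meaningful only where existence and uniqueness hold.\<close>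

definition mild_sol ::
  "(real \<Rightarrow> 'h \<Rightarrow>\<^sub>L 'h::{banach, second_countable_topology}) \<Rightarrow> ('h \<Rightarrow> 'h) \<Rightarrow> ('v \<Rightarrow> 'h) \<Rightarrow>
   real \<Rightarrow> real \<Rightarrow> 'h \<Rightarrow> (real \<Rightarrow> 'v) \<Rightarrow> (real \<Rightarrow> 'h)" where
  "mild_sol S F C t T x u = (THE y. is_mild_solution S F C t T x u y)"

definition galerkin_sol ::
  "('h \<Rightarrow> 'h) \<Rightarrow> ('h \<Rightarrow> 'h) \<Rightarrow> ('h \<Rightarrow> 'h) \<Rightarrow> ('v \<Rightarrow> 'h::{banach, second_countable_topology}) \<Rightarrow>
   real \<Rightarrow> real \<Rightarrow> 'h \<Rightarrow> (real \<Rightarrow> 'v) \<Rightarrow> (real \<Rightarrow> 'h)" where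
  "galerkin_sol P L F C t T x u = (THE y. is_galerkin_solution P L F C t T x u y)"

end

(*
  After a time shift every problem started at t becomes a problem started at 0, so it suffices
  to bound the Galerkin error on [0,T] uniformly in the control. By (e) the states y(s;u) are
  uniformly close to bounded subsets of the finite-dimensional spaces H N, hence relatively
  compact; so all values F(y(s;u)) and C(u(s)) lie in one compact set. On compact sets the
  Trotter-Kato theorem gives T_N(t) P_N z -> T(t) z uniformly in t and z, and Gronwall's
  inequality turns this into the uniform estimate for y_N - y.

  For Trotter-Kato, telescoping over a fine partition bounds the semigroup error by the defect
  (P_N L - L_N) along an orbit. On orbit averages int_0^h T(r) x dr this defect is a
  strongly convergent sequence of bounded operators applied to T(s) x, so the uniform boundedness
  principle and compactness of the orbit make it uniformly small.
*)

theory Submission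
  imports Defs
begin

text \<open>The semigroups converge only pointwise in the state, so uniformity over the controls
  must come from the set of arguments; this is why compactness of all integrand values is the hinge.
  The same obstacle returns one level down: (b) is convergence at each single element of
  \<open>D\<close>, the norms of the \<open>L_N\<close> need not stay bounded in \<open>N\<close>,
  and compactness of an orbit in the ambient space gives nothing for an unbounded operator.
  Averaging first cures this, because \<open>L\<close> composed with \<open>avg h\<close> is
  \<open>S h - id\<close>, bounded on the whole space; neither a graph norm nor resolvents enter.
  Well-posedness and the bounds are given only for problems started at 0. A control on
  \<open>{t..T}\<close> is therefore moved to 0 and continued up to \<open>T\<close> by a fixed
  element of \<open>U\<close>, so that the estimate for the single horizon \<open>T\<close> covers
  every starting time.\<close>

section \<open>Orthogonal projectors onto finite-dimensional subspaces\<close>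

text \<open>Both \<open>x - Q\<close> and \<open>x - P x\<close> are orthogonal to the span, and
  their difference \<open>P x - Q\<close> lies in it. Linearity of \<open>P\<close>, its boundedness
  and the compactness of its bounded images are later read off from these coordinates.\<close>

lemma orthogonal_projector_formula:
  assumes P: "is_orthogonal_projector (span C) P" and C: "finite C" "pairwise orthogonal C"
  shows "P x = (\<Sum>c\<in>C. (inner x c / inner c c) *\<^sub>R c)"
proof -
  define Q where "Q = (\<Sum>c\<in>C. (inner x c / inner c c) *\<^sub>R c)"
  have Qspan: "Q \<in> span C"
    unfolding Q_def by (intro span_sum span_scale span_base)
  have Qperp: "inner (x - Q) d = 0" if d: "d \<in> C" for d
  proof -
    have "inner Q d = (\<Sum>c\<in>C. (inner x c / inner c c) * inner c d)"
      unfolding Q_def by (simp add: inner_sum_left)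
    also have "\<dots> = (\<Sum>c\<in>{d}. (inner x c / inner c c) * inner c d)"
    proof (rule sum.mono_neutral_right)
      show "\<forall>i\<in>C - {d}. inner x i / inner i i * inner i d = 0"
        using C(2) d by (auto simp: pairwise_def orthogonal_def)
    qed (use C d in auto)
    \<comment> \<open>\<open>C\<close> may contain 0; the coefficient is then 0/0 = 0 and both sides
      vanish.\<close>
    also have "\<dots> = inner x d"
      by (cases "d = 0") auto
    finally show ?thesis by (simp add: inner_diff_left)
  qed
  have "orthogonal (x - Q) (P x - Q)"
  proof (rule orthogonal_to_span)
    show "P x - Q \<in> span C"
      using P Qspan by (auto simp: is_orthogonal_projector_def intro: span_diff)
  qed (use Qperp in \<open>auto simp: orthogonal_def\<close>)
  moreover have "inner (x - P x) (P x - Q) = 0"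
    using P Qspan by (auto simp: is_orthogonal_projector_def intro: span_diff)
  ultimately have "inner ((x - Q) - (x - P x)) (P x - Q) = 0"
    by (simp add: orthogonal_def inner_diff_left)
  then show ?thesis by (simp add: Q_def)
qed

lemma orthogonal_projector_norm_le:
  assumes "is_orthogonal_projector W P"
  shows "norm (P x) \<le> norm x"
proof -
  have "inner (x - P x) (P x) = 0"
    using assms by (auto simp: is_orthogonal_projector_def)
  then have "inner (P x) (P x) = inner x (P x)" by (simp add: inner_diff_left)
  also have "\<dots> \<le> norm x * norm (P x)" by (rule norm_cauchy_schwarz)
  finally have "norm (P x) * norm (P x) \<le> norm x * norm (P x)"
    by (simp add: power2_norm_eq_inner[symmetric] power2_eq_square)
  then show ?thesis
    by (cases "P x = 0") auto
qed

lemma orthogonal_projector_fixes: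
  assumes P: "is_orthogonal_projector W P" and W: "subspace W" "z \<in> W"
  shows "P z = z"
proof -
  have "z - P z \<in> W" using assms by (auto simp: is_orthogonal_projector_def intro!: subspace_diff)
  then have "inner (z - P z) (z - P z) = 0"
    using P unfolding is_orthogonal_projector_def by blast
  then show ?thesis by simp
qed

lemma bounded_linear_orthogonal_projector:
  assumes P: "is_orthogonal_projector (span B) P" and "finite B"
  shows "bounded_linear P"
proof -
  obtain C where C: "finite C" "span C = span B" "pairwise orthogonal C"
    using basis_orthogonal[OF \<open>finite B\<close>] by blast
  have eq: "P = (\<lambda>x. \<Sum>c\<in>C. (inner x c / inner c c) *\<^sub>R c)"
    using orthogonal_projector_formula[OF _ C(1,3)] P C(2) by auto
  show ?thesis
    unfolding eq
    unfolding divide_inverse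
    by (intro bounded_linear_sum bounded_linear_scaleR_const bounded_linear_mult_const
        bounded_linear_inner_left)
qed

text \<open>The ambient space may be infinite-dimensional, so bounded closed sets are not compact in
  general. Here compactness is built up one segment at a time, sums of compact sets being compact;
  \<open>C\<close> may be linearly dependent.\<close>

lemma compact_coefficient_box:
  fixes C :: "'a::real_normed_vector set"
  assumes "finite C"
  shows "compact {\<Sum>c\<in>C. a c *\<^sub>R c | a. \<forall>c\<in>C. \<bar>a c\<bar> \<le> (r::real)}"
  using assms
proof (induction C)
  case empty
  then show ?case by simp
next
  case (insert d C)
  have "compact ((\<lambda>t. t *\<^sub>R d) ` {-r..r})"
    by (intro compact_continuous_image continuous_intros compact_Icc)
  from compact_sums[OF this insert.IH]
  have "compact {x + y | x y. x \<in> (\<lambda>t. t *\<^sub>R d) ` {-r..r} \<and>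
      y \<in> {\<Sum>c\<in>C. a c *\<^sub>R c | a. \<forall>c\<in>C. \<bar>a c\<bar> \<le> r}}" .
  also have "{x + y | x y. x \<in> (\<lambda>t. t *\<^sub>R d) ` {-r..r} \<and>
      y \<in> {\<Sum>c\<in>C. a c *\<^sub>R c | a. \<forall>c\<in>C. \<bar>a c\<bar> \<le> r}}
    = {\<Sum>c\<in>insert d C. a c *\<^sub>R c | a. \<forall>c\<in>insert d C. \<bar>a c\<bar> \<le> r}" (is "?A = ?B")
  proof (intro equalityI subsetI)
    fix z assume "z \<in> ?A"
    then obtain t a where ta: "t \<in> {-r..r}" "\<forall>c\<in>C. \<bar>a c\<bar> \<le> r"
      "z = t *\<^sub>R d + (\<Sum>c\<in>C. a c *\<^sub>R c)" by blast
    have "(\<Sum>c\<in>C. (a(d := t)) c *\<^sub>R c) = (\<Sum>c\<in>C. a c *\<^sub>R c)"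
      using insert.hyps by (intro sum.cong) auto
    then have "z = (\<Sum>c\<in>insert d C. (a(d := t)) c *\<^sub>R c)"
      using insert.hyps ta by simp
    moreover have "\<forall>c\<in>insert d C. \<bar>(a(d := t)) c\<bar> \<le> r"
      using ta by auto
    ultimately show "z \<in> ?B" by blast
  next
    fix z assume "z \<in> ?B"
    then obtain a where "\<forall>c\<in>insert d C. \<bar>a c\<bar> \<le> r" "z = (\<Sum>c\<in>insert d C. a c *\<^sub>R c)" by blast
    then have "z = a d *\<^sub>R d + (\<Sum>c\<in>C. a c *\<^sub>R c)" "a d \<in> {-r..r}" "\<forall>c\<in>C. \<bar>a c\<bar> \<le> r"
      using insert.hyps by auto
    then show "z \<in> ?A" by blast
  qed
  finally show ?case .
qed

lemma orthogonal_projector_bounded_image_compact: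
  assumes P: "is_orthogonal_projector (span B) P" and "finite B"
  shows "\<exists>K. compact K \<and> P ` cball 0 r \<subseteq> K"
proof -
  obtain C where C: "finite C" "span C = span B" "pairwise orthogonal C"
    using basis_orthogonal[OF \<open>finite B\<close>] by blast
  \<comment> \<open>A sum rather than a maximum: it dominates every coefficient bound and also makes
    sense for empty \<open>C\<close>.\<close>
  define q where "q = (\<Sum>c\<in>C. r * norm c / inner c c)"
  have "\<bar>inner x c / inner c c\<bar> \<le> q" if x: "norm x \<le> r" and c: "c \<in> C" for x c
  proof -
    have "\<bar>inner x c / inner c c\<bar> \<le> norm x * norm c / inner c c"
      by (simp add: Cauchy_Schwarz_ineq2 divide_right_mono)
    also have "\<dots> \<le> r * norm c / inner c c"
      using x by (intro divide_right_mono mult_right_mono) auto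
    also have "\<dots> \<le> q"
      unfolding q_def
    proof (rule member_le_sum[OF c _ C(1)])
      have "0 \<le> r" using norm_ge_zero x by (rule order_trans)
      then show "0 \<le> r * norm c / inner c c" for c :: 'a by simp
    qed
    finally show ?thesis .
  qed
  then have "P ` cball 0 r \<subseteq> {\<Sum>c\<in>C. a c *\<^sub>R c | a. \<forall>c\<in>C. \<bar>a c\<bar> \<le> q}"
    using orthogonal_projector_formula[OF _ C(1,3), of P] P C(2) by (auto simp: dist_norm)
  then show ?thesis using compact_coefficient_box[OF C(1)] by blast
qed

section \<open>Uniform boundedness and uniform convergence on compact sets\<close>

text \<open>Baire: the closed sets \<open>G k\<close> exhaust the space, so one of them contains a
  ball, and linearity carries the bound on this ball to all vectors.\<close>

lemma uniform_boundedness_principle: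
  fixes f :: "nat \<Rightarrow> 'a::banach \<Rightarrow> 'b::real_normed_vector"
  assumes lin: "\<And>n. bounded_linear (f n)" and bdd: "\<And>x. bounded (range (\<lambda>n. f n x))"
  shows "\<exists>K. \<forall>n x. norm (f n x) \<le> K * norm x"
proof -
  define G where "G k = {x. \<forall>n. norm (f n x) \<le> real k}" for k :: nat
  have closedG: "closed (G k)" for k
    unfolding G_def
    by (intro closed_Collect_all closed_Collect_le continuous_intros
        linear_continuous_on[OF lin, THEN continuous_on_norm])
  have "\<Union>(range G) = UNIV"
  proof -
    have "\<exists>k. x \<in> G k" for x
    proof -
      obtain b where "\<forall>n. norm (f n x) \<le> b" using bdd[of x] by (auto simp: bounded_iff)
      then show ?thesis
        unfolding G_def using real_arch_simple[of b] order_trans by blast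
    qed
    then show ?thesis by auto
  qed
  moreover have "euclidean interior_of \<Union>(range G) = {}" if "\<And>k. interior (G k) = {}"
    by (rule Baire_category_alt)
      (use closedG that in \<open>auto simp: completely_metrizable_space_euclidean\<close>)
  ultimately obtain k where "interior (G k) \<noteq> {}" by force
  then obtain x0 e where e: "e > 0" "ball x0 e \<subseteq> G k"
    by (metis all_not_in_conv mem_interior)
  \<comment> \<open>One factor 2 of the 4 comes from subtracting the value at the centre
    \<open>x0\<close>, the other from scaling \<open>x\<close> to half the radius so as to stay
    inside the open ball.\<close>
  have "norm (f n x) \<le> (4 * real k / e) * norm x" for n x
  proof (cases "x = 0")
    case True
    then show ?thesis using lin[of n] by (simp add: linear_0 bounded_linear.linear)
  next
    case False
    interpret f: bounded_linear "f n" by (rule lin)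
    define s where "s = e / (2 * norm x)"
    have s: "s > 0" using e False by (simp add: s_def)
    have "norm (s *\<^sub>R x) < e" using e False by (simp add: s_def)
    then have "x0 + s *\<^sub>R x \<in> G k" "x0 \<in> G k" using e by (auto simp: dist_norm)
    then have "norm (f n (x0 + s *\<^sub>R x)) \<le> k" "norm (f n x0) \<le> k" by (auto simp: G_def)
    then have "norm (f n (x0 + s *\<^sub>R x) - f n x0) \<le> 2 * k"
      using norm_triangle_ineq4[of "f n (x0 + s *\<^sub>R x)" "f n x0"] by linarith
    then have "s * norm (f n x) \<le> 2 * k" using s by (simp add: f.add f.scaleR)
    then have "norm (f n x) \<le> 2 * k / s" using s by (simp add: field_simps)
    then show ?thesis by (simp add: s_def field_simps)
  qed
  then show ?thesis by blast
qed

text \<open>The index \<open>i\<close> carries a parameter (later: time) in which the pointwise convergence is already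
  uniform.\<close>

lemma uniform_on_compact:
  fixes d :: "'n \<Rightarrow> 'i \<Rightarrow> 'a::metric_space \<Rightarrow> 'b::real_normed_vector"
  assumes lip: "\<forall>\<^sub>F n in \<FF>. \<forall>i\<in>I. \<forall>x y. norm (d n i x - d n i y) \<le> K * dist x y"
    and ptw: "\<And>x e. x \<in> X \<Longrightarrow> 0 < e \<Longrightarrow> \<forall>\<^sub>F n in \<FF>. \<forall>i\<in>I. norm (d n i x) < e"
    and X: "compact X" and e: "e > 0"
  shows "\<forall>\<^sub>F n in \<FF>. \<forall>i\<in>I. \<forall>x\<in>X. norm (d n i x) < e"
proof -
  \<comment> \<open>Half of \<open>e\<close> is spent on moving to a net point, half at the net
    point. \<open>\<bar>K\<bar> + 1\<close> is positive whatever the sign of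
    \<open>K\<close>.\<close>
  define \<delta> where "\<delta> = e / (2 * (\<bar>K\<bar> + 1))"
  have \<delta>: "\<delta> > 0" using e by (simp add: \<delta>_def add_nonneg_pos)
  obtain k where k: "finite k" "k \<subseteq> X" "X \<subseteq> (\<Union>x\<in>k. ball x \<delta>)"
    using compactE_image[OF X, of X "\<lambda>x. ball x \<delta>"] \<delta>
    by (metis (no_types, lifting) UN_I centre_in_ball open_ball subsetI)
  have "\<forall>\<^sub>F n in \<FF>. \<forall>x\<in>k. \<forall>i\<in>I. norm (d n i x) < e / 2"
    using k ptw[of _ "e/2"] e by (intro eventually_ball_finite) auto
  with lip show ?thesis
  proof eventually_elim
    case (elim n)
    show ?case
    proof (intro ballI)
      fix i x assume i: "i \<in> I" and "x \<in> X"
      then obtain z where z: "z \<in> k" "dist x z < \<delta>" using k by (auto simp: dist_commute)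
      have "norm (d n i x - d n i z) \<le> K * dist x z" using elim i by blast
      also have "\<dots> \<le> (\<bar>K\<bar> + 1) * dist x z" by (intro mult_right_mono) auto
      also have "\<dots> \<le> (\<bar>K\<bar> + 1) * \<delta>" using z by (intro mult_left_mono) auto
      also have "\<dots> = e / 2" by (simp add: \<delta>_def divide_simps)
      finally have "norm (d n i x - d n i z) \<le> e / 2" .
      moreover have "norm (d n i z) < e / 2" using elim i z by blast
      ultimately show "norm (d n i x) < e"
        using norm_triangle_sub[of "d n i x" "d n i z"] by linarith
    qed
  qed
qed

text \<open>An equi-Lipschitz family transfers smallness from a nearby point of \<open>X\<close>; a
  single such point suffices, so no compactness is involved.\<close>

lemma uniform_from_dense:
  fixes d :: "'n \<Rightarrow> 'i \<Rightarrow> 'a::metric_space \<Rightarrow> 'b::real_normed_vector"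
  assumes lip: "\<forall>\<^sub>F n in \<FF>. \<forall>i\<in>I. \<forall>x y. norm (d n i x - d n i y) \<le> K * dist x y"
    and ptw: "\<And>x e. x \<in> X \<Longrightarrow> 0 < e \<Longrightarrow> \<forall>\<^sub>F n in \<FF>. \<forall>i\<in>I. norm (d n i x) < e"
    and x: "x \<in> closure X" and e: "e > 0"
  shows "\<forall>\<^sub>F n in \<FF>. \<forall>i\<in>I. norm (d n i x) < e"
proof -
  have "0 < e / (2 * (\<bar>K\<bar> + 1))" using e by (simp add: add_nonneg_pos)
  then obtain z where z: "z \<in> X" "dist z x < e / (2 * (\<bar>K\<bar> + 1))"
    using x by (auto simp: closure_approachable)
  have *: "K * dist x z \<le> e / 2"
  proof -
    have "K * dist x z \<le> (\<bar>K\<bar> + 1) * dist x z" by (intro mult_right_mono) auto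
    also have "\<dots> \<le> (\<bar>K\<bar> + 1) * (e / (2 * (\<bar>K\<bar> + 1)))"
      using z by (intro mult_left_mono) (auto simp: dist_commute)
    also have "\<dots> = e / 2" by (simp add: divide_simps)
    finally show ?thesis .
  qed
  have "\<forall>\<^sub>F n in \<FF>. \<forall>i\<in>I. norm (d n i z) < e / 2" using ptw[OF z(1), of "e / 2"] e by simp
  with lip show ?thesis
  proof eventually_elim
    case (elim n)
    show ?case
    proof
      fix i assume i: "i \<in> I"
      have "norm (d n i x - d n i z) \<le> e / 2" using elim i * by (meson order_trans)
      moreover have "norm (d n i z) < e / 2" using elim i by blast
      ultimately show "norm (d n i x) < e"
        using norm_triangle_sub[of "d n i x" "d n i z"] by linarith
    qed
  qed
qed

text \<open>Total boundedness: a finite net of \<open>K\<close> is also a net of \<open>Y\<close>,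
  and of its closure, at the cost of three errors below \<open>e/4\<close>. The sets
  \<open>K\<close> will be images of a ball under the projectors.\<close>

lemma compact_closure_if_nearly_compact:
  fixes Y :: "'a::complete_space set"
  assumes "\<And>e. e > 0 \<Longrightarrow> \<exists>K. compact K \<and> (\<forall>y\<in>Y. \<exists>z\<in>K. dist y z < e)"
  shows "compact (closure Y)"
  unfolding compact_eq_totally_bounded
proof (intro conjI allI impI)
  show "complete (closure Y)" by (simp add: complete_eq_closed)
next
  fix e :: real assume e: "e > 0"
  then obtain K where K: "compact K" "\<forall>y\<in>Y. \<exists>z\<in>K. dist y z < e / 4"
    using assms[of "e/4"] by auto
  obtain k where k: "finite k" "K \<subseteq> (\<Union>x\<in>k. ball x (e/4))"
    using K(1) e unfolding compact_eq_totally_bounded by (meson zero_less_divide_iff zero_less_numeral)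
  have "closure Y \<subseteq> (\<Union>x\<in>k. ball x e)"
  proof
    fix y assume "y \<in> closure Y"
    then obtain y' where y': "y' \<in> Y" "dist y' y < e / 4"
      using e by (meson closure_approachable zero_less_divide_iff zero_less_numeral)
    obtain z where z: "z \<in> K" "dist y' z < e / 4" using K y' by blast
    obtain x where x: "x \<in> k" "dist x z < e / 4" using k z by auto
    have "dist x y \<le> dist x z + dist y' z + dist y' y"
      using dist_triangle[of x y z] dist_triangle[of z y y'] by (simp add: dist_commute)
    then have "dist x y < e" using x z y' e by linarith
    then show "y \<in> (\<Union>x\<in>k. ball x e)" using x by auto
  qed
  then show "\<exists>k. finite k \<and> closure Y \<subseteq> (\<Union>x\<in>k. ball x e)" using k by blast
qed

section \<open>Increments, the exponential series, Gronwall and one-sided derivatives\<close>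

text \<open>A substitute for the mean value inequality that needs neither differentiability nor
  continuity: the interval is cut into \<open>n\<close> equal pieces.\<close>

lemma norm_increment_le_if_uniform_quotient_le:
  fixes g :: "real \<Rightarrow> 'a::real_normed_vector"
  assumes t: "0 \<le> t"
    and q: "\<And>e. e > 0 \<Longrightarrow> \<exists>\<delta>>0. \<forall>s h. 0 \<le> s \<longrightarrow> 0 < h \<longrightarrow> s + h \<le> t \<longrightarrow> h < \<delta> \<longrightarrow>
              norm (g (s + h) - g s) \<le> h * (b + e)"
  shows "norm (g t - g 0) \<le> t * b"
proof (rule field_le_epsilon)
  fix e' :: real assume e': "e' > 0"
  \<comment> \<open>With \<open>t + 1\<close> instead of \<open>t\<close> the quotient exists for
    \<open>t = 0\<close>, and still \<open>t * e \<le> e'\<close>.\<close>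
  define e where "e = e' / (t + 1)"
  have e: "e > 0" using e' t by (simp add: e_def)
  obtain \<delta> where \<delta>: "\<delta> > 0" and *: "\<And>s h. 0 \<le> s \<Longrightarrow> 0 < h \<Longrightarrow> s + h \<le> t \<Longrightarrow> h < \<delta> \<Longrightarrow>
              norm (g (s + h) - g s) \<le> h * (b + e)"
    using q[OF e] by blast
  show "norm (g t - g 0) \<le> t * b + e'"
  proof (cases "t = 0")
    case False
    then have t0: "t > 0" using t by simp
    obtain n where n: "t / \<delta> < real n" using reals_Archimedean2 by blast
    have n0: "real n > 0" using n t0 \<delta> by (meson divide_pos_pos order_less_trans)
    define h where "h = t / n"
    have h: "0 < h" "h < \<delta>" "n * h = t"
      using n n0 t0 \<delta> by (auto simp: h_def field_simps)
    have "g t - g 0 = (\<Sum>k<n. g (real (Suc k) * h) - g (real k * h))"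
      using sum_lessThan_telescope[of "\<lambda>k. g (real k * h)" n] h by simp
    also have "norm \<dots> \<le> (\<Sum>k<n. h * (b + e))"
    proof (rule sum_norm_le)
      fix k assume k: "k \<in> {..<n}"
      have "real (Suc k) * h \<le> n * h" using k h by (intro mult_right_mono) auto
      then have "real k * h + h \<le> t" using h by (simp add: algebra_simps)
      from *[OF _ h(1) this h(2)] h show "norm (g (real (Suc k) * h) - g (real k * h)) \<le> h * (b + e)"
        by (simp add: algebra_simps)
    qed
    also have "\<dots> = t * (b + e)" using h by (simp add: algebra_simps flip: h(3))
    also have "\<dots> \<le> t * b + e'"
    proof -
      have "t * e \<le> (t + 1) * e" using e by simp
      also have "\<dots> = e'" using t by (simp add: e_def)
      finally show ?thesis by (simp add: algebra_simps)
    qed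
    finally show ?thesis .
  qed (use e' in simp)
qed

text \<open>What remains is the series from \<open>k = 2\<close> on, where
  \<open>h ^ k \<le> h\<^sup>2\<close>. The constant \<open>exp a\<close> may grow with the
  dimension of the Galerkin space; this is harmless because the partition is refined at fixed
  \<open>N\<close>.\<close>

lemma exp_flow_first_order:
  fixes A :: "'a::banach \<Rightarrow> 'a"
  assumes A: "\<And>x. norm (A x) \<le> a * norm x" and a: "a \<ge> 0" and h: "0 \<le> h" "h \<le> 1"
  shows "norm (exp_flow A h x - x - h *\<^sub>R A x) \<le> h\<^sup>2 * exp a * norm x"
proof -
  define f where "f k = (h ^ k / fact k) *\<^sub>R (A ^^ k) x" for k
  have pow: "norm ((A ^^ k) x) \<le> a ^ k * norm x" for k
  proof (induction k)
    case (Suc k)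
    have "norm ((A ^^ Suc k) x) \<le> a * norm ((A ^^ k) x)" using A by simp
    also have "\<dots> \<le> a * (a ^ k * norm x)" using Suc a by (intro mult_left_mono)
    finally show ?case by simp
  qed simp
  have f_le: "norm (f k) \<le> h ^ k * (a ^ k / fact k * norm x)" for k
  proof -
    have "norm (f k) = h ^ k / fact k * norm ((A ^^ k) x)" using h by (simp add: f_def)
    also have "\<dots> \<le> h ^ k / fact k * (a ^ k * norm x)"
      using pow[of k] h by (intro mult_left_mono) auto
    finally show ?thesis by simp
  qed
  have sumexp: "(\<lambda>k. a ^ k / fact k * norm x) sums (exp a * norm x)"
    using sums_mult2[OF exp_converges[of a]] by (simp add: divide_inverse_commute)
  have f_le': "norm (f k) \<le> a ^ k / fact k * norm x" for k
  proof -
    have "h ^ k * (a ^ k / fact k * norm x) \<le> 1 * (a ^ k / fact k * norm x)"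
      using h a by (intro mult_right_mono power_le_one) auto
    then show ?thesis using f_le[of k] by linarith
  qed
  have sf: "summable f"
    using summable_comparison_test'[OF sums_summable[OF sumexp]] f_le' by blast
  have tail_le: "norm (f (k + 2)) \<le> h\<^sup>2 * (a ^ (k + 2) / fact (k + 2) * norm x)" for k
  proof -
    have "h ^ (k + 2) \<le> h\<^sup>2" using h by (intro power_decreasing) auto
    then have "h ^ (k + 2) * (a ^ (k + 2) / fact (k + 2) * norm x)
        \<le> h\<^sup>2 * (a ^ (k + 2) / fact (k + 2) * norm x)"
      using a by (intro mult_right_mono) auto
    then show ?thesis using f_le[of "k + 2"] by linarith
  qed
  have st: "summable (\<lambda>k. a ^ (k + 2) / fact (k + 2) * norm x)"
    using summable_ignore_initial_segment[OF sums_summable[OF sumexp], of 2] .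
  have "exp_flow A h x = (\<Sum>k. f (k + 2)) + sum f {..<2}"
    unfolding exp_flow_def f_def[symmetric] by (rule suminf_split_initial_segment[OF sf])
  then have "exp_flow A h x - x - h *\<^sub>R A x = (\<Sum>k. f (k + 2))"
    by (simp add: f_def numeral_2_eq_2)
  also have "norm \<dots> \<le> (\<Sum>k. h\<^sup>2 * (a ^ (k + 2) / fact (k + 2) * norm x))"
    by (rule norm_suminf_le[OF tail_le summable_mult[OF st]])
  also have "\<dots> = h\<^sup>2 * (\<Sum>k. a ^ (k + 2) / fact (k + 2) * norm x)"
    by (rule suminf_mult[OF st])
  also have "\<dots> \<le> h\<^sup>2 * (exp a * norm x)"
  proof (rule mult_left_mono)
    have "(\<Sum>k. a ^ k / fact k * norm x) = (\<Sum>k. a ^ (k + 2) / fact (k + 2) * norm x)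
        + (\<Sum>k<2. a ^ k / fact k * norm x)"
      by (rule suminf_split_initial_segment[OF sums_summable[OF sumexp]])
    moreover have "(\<Sum>k<2. a ^ k / fact k * norm x) \<ge> 0" using a by (intro sum_nonneg) auto
    ultimately show "(\<Sum>k. a ^ (k + 2) / fact (k + 2) * norm x) \<le> exp a * norm x"
      using sums_unique[OF sumexp] by linarith
  qed simp
  finally show ?thesis by (simp add: mult.assoc)
qed

text \<open>Take the maximum \<open>m\<close> of \<open>\<delta>\<close> weighted by
  \<open>exp (- 2 * b * s)\<close>. With the doubled rate, the integral term returns at most half of
  the left-hand side at the maximum point and can be absorbed. The price is the constants
  \<open>2 * a\<close> and \<open>2 * b\<close>.\<close>

lemma gronwall_le:
  fixes \<delta> :: "real \<Rightarrow> real"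
  assumes cont: "continuous_on {0..T} \<delta>" and b: "b > 0" and T: "T \<ge> 0"
    and le: "\<And>t. t \<in> {0..T} \<Longrightarrow> \<delta> t \<le> a + b * integral {0..t} \<delta>"
    and t: "t \<in> {0..T}" and a: "a \<ge> 0"
  shows "\<delta> t \<le> 2 * a * exp (2 * b * t)"
proof -
  define w where "w s = \<delta> s * exp (- 2 * b * s)" for s
  have "continuous_on {0..T} w" unfolding w_def by (intro continuous_intros cont)
  then obtain s0 where s0: "s0 \<in> {0..T}" "\<And>s. s \<in> {0..T} \<Longrightarrow> w s \<le> w s0"
    using continuous_attains_sup[of "{0..T}" w] T by auto
  define m where "m = w s0"
  have \<delta>_le: "\<delta> s \<le> m * exp (2 * b * s)" if "s \<in> {0..T}" for s
  proof -
    have "\<delta> s = w s * exp (2 * b * s)" by (simp add: w_def exp_minus)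
    also have "\<dots> \<le> m * exp (2 * b * s)"
      using s0(2)[OF that] by (simp add: m_def)
    finally show ?thesis .
  qed
  have int: "((\<lambda>s. m * exp (2 * b * s)) has_integral m * exp (2 * b * s0) / (2 * b) - m * exp (2 * b * 0) / (2 * b)) {0..s0}"
    using s0 b by (intro fundamental_theorem_of_calculus)
      (auto simp flip: has_real_derivative_iff_has_vector_derivative intro!: derivative_eq_intros)
  have "m \<le> 2 * a"
  proof (cases "m \<le> 0")
    case True
    then show ?thesis using a by simp
  next
    case False
    have "integral {0..s0} \<delta> \<le> integral {0..s0} (\<lambda>s. m * exp (2 * b * s))"
      using s0 \<delta>_le by (intro integral_le integrable_continuous_real continuous_intros
          continuous_on_subset[OF cont]) auto
    also have "\<dots> = m * (exp (2 * b * s0) - 1) / (2 * b)"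
      using integral_unique[OF int] by (simp add: algebra_simps diff_divide_distrib)
    finally have "\<delta> s0 \<le> a + b * (m * (exp (2 * b * s0) - 1) / (2 * b))"
      using le[OF s0(1)] b by (smt (verit) mult_left_mono)
    then have "\<delta> s0 \<le> a + m * (exp (2 * b * s0) - 1) / 2" using b by simp
    moreover have "\<delta> s0 = m * exp (2 * b * s0)"
      by (simp add: m_def w_def exp_minus)
    ultimately have "m * exp (2 * b * s0) \<le> 2 * a - m" by (simp add: right_diff_distrib diff_divide_distrib)
    moreover have "m * 1 \<le> m * exp (2 * b * s0)"
      using False b s0 by (intro mult_left_mono) auto
    ultimately show ?thesis using a False by linarith
  qed
  then show ?thesis using \<delta>_le[OF t]
    by (meson exp_ge_zero mult_right_mono order_trans)
qed

text \<open>Averages over shrinking windows inherit the value at the left end point; one-sided, like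
  the limits that define a generator.\<close>

lemma integral_quotient_tendsto_right:
  fixes f :: "real \<Rightarrow> 'a::banach"
  assumes f: "continuous_on {a..b} f" and "a < b"
  shows "((\<lambda>\<delta>. integral {a..a + \<delta>} f /\<^sub>R \<delta>) \<longlongrightarrow> f a) (at_right 0)"
proof (rule tendstoI)
  fix e :: real assume e: "e > 0"
  obtain d where d: "d > 0" "\<And>r. r \<in> {a..b} \<Longrightarrow> dist r a < d \<Longrightarrow> dist (f r) (f a) < e / 2"
    using f e \<open>a < b\<close> unfolding continuous_on_iff
    by (metis atLeastAtMost_iff half_gt_zero less_eq_real_def)
  have "dist (integral {a..a + \<delta>} f /\<^sub>R \<delta>) (f a) < e" if \<delta>: "0 < \<delta>" "\<delta> < min d (b - a)" for \<delta>
  proof -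
    have cont: "continuous_on {a..a + \<delta>} f"
      using f by (rule continuous_on_subset) (use \<delta> in auto)
    have "integral {a..a + \<delta>} (\<lambda>r. f r - f a) = integral {a..a + \<delta>} f - \<delta> *\<^sub>R f a"
      using \<delta> by (subst integral_diff) (auto intro!: integrable_continuous_real cont)
    moreover have "norm (integral {a..a + \<delta>} (\<lambda>r. f r - f a)) \<le> e / 2 * (a + \<delta> - a)"
    proof (rule integral_bound)
      show "norm (f r - f a) \<le> e / 2" if "r \<in> {a..a + \<delta>}" for r
        using d(2)[of r] that \<delta> by (auto simp: dist_norm)
    qed (use \<delta> cont in \<open>auto intro!: continuous_intros\<close>)
    ultimately have "norm (integral {a..a + \<delta>} f - \<delta> *\<^sub>R f a) \<le> e / 2 * \<delta>" by simp
    moreover have "integral {a..a + \<delta>} f /\<^sub>R \<delta> - f a = (integral {a..a + \<delta>} f - \<delta> *\<^sub>R f a) /\<^sub>R \<delta>"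
      using \<delta> by (simp add: scaleR_diff_right)
    ultimately have "norm (integral {a..a + \<delta>} f /\<^sub>R \<delta> - f a) \<le> inverse \<delta> * (e / 2 * \<delta>)"
      using \<delta> by simp
    then show ?thesis using e \<delta> by (simp add: dist_norm field_simps)
  qed
  then show "\<forall>\<^sub>F \<delta> in at_right 0. dist (integral {a..a + \<delta>} f /\<^sub>R \<delta>) (f a) < e"
    unfolding eventually_at_right_field using d(1) \<open>a < b\<close>
    by (intro exI[of _ "min d (b - a)"]) auto
qed

section \<open>Strongly continuous semigroups and orbit averages\<close>

locale bounded_c0_semigroup =
  fixes S :: "real \<Rightarrow> 'h \<Rightarrow>\<^sub>L 'h::banach" and M \<omega> :: real
  assumes c0: "c0_semigroup S" and M_ge_1: "M \<ge> 1" and omega_nonneg: "\<omega> \<ge> 0"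
    and growth: "t \<ge> 0 \<Longrightarrow> norm (S t) \<le> M * exp (\<omega> * t)"
begin

text \<open>Since \<omega> is nonnegative, this one number bounds \<open>norm (S t)\<close> for all
  \<open>t\<close> in \<open>{0..T}\<close>. The Galerkin semigroups share \<open>M\<close> and
  \<omega>, hence also this bound.\<close>

definition growth_bound :: "real \<Rightarrow> real" where "growth_bound T = M * exp (\<omega> * T)"

lemma growth_bound_ge_1: "T \<ge> 0 \<Longrightarrow> growth_bound T \<ge> 1"
  unfolding growth_bound_def using M_ge_1 omega_nonneg
  by (metis mult_mono' mult_1 one_le_exp_iff mult_nonneg_nonneg zero_le_one)

lemma norm_apply_le:
  assumes "0 \<le> t" "t \<le> T"
  shows "norm (S t x) \<le> growth_bound T * norm x"
proof -
  have "norm (S t x) \<le> norm (S t) * norm x" by (rule norm_blinfun)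
  also have "\<dots> \<le> growth_bound T * norm x"
  proof (rule mult_right_mono)
    have "M * exp (\<omega> * t) \<le> growth_bound T"
      unfolding growth_bound_def using assms M_ge_1 omega_nonneg
      by (intro mult_left_mono) (auto intro: mult_left_mono)
    then show "norm (S t) \<le> growth_bound T" using growth[OF assms(1)] by linarith
  qed simp
  finally show ?thesis .
qed

lemma apply_0 [simp]: "S 0 x = x"
  using c0 by (simp add: c0_semigroup_def)

lemma apply_add: "s \<ge> 0 \<Longrightarrow> t \<ge> 0 \<Longrightarrow> S (s + t) x = S s (S t x)"
  using c0 by (simp add: c0_semigroup_def)

text \<open>Continuity is postulated only from the right at 0. Factoring out the semigroup at the
  earlier of two times reduces both one-sided limits to this, with the growth bound making the
  modulus independent of that earlier time.\<close>

lemma continuous_on_orbit: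
  assumes "a \<ge> 0"
  shows "continuous_on {a..T} (\<lambda>t. S t x)"
  unfolding continuous_on_iff
proof (intro ballI allI impI)
  fix t e :: real assume t: "t \<in> {a..T}" and e: "e > 0"
  define K where "K = growth_bound T"
  have K: "K \<ge> 1" using growth_bound_ge_1 t assms by (simp add: K_def)
  have "((\<lambda>h. S h x) \<longlongrightarrow> x) (at_right 0)" using c0 by (simp add: c0_semigroup_def)
  then have "\<forall>\<^sub>F h in at_right 0. dist (S h x) x < e / K"
    using e K by (intro tendstoD) auto
  then obtain \<delta> where \<delta>: "\<delta> > 0" "\<And>h. 0 < h \<Longrightarrow> h < \<delta> \<Longrightarrow> dist (S h x) x < e / K"
    unfolding eventually_at_right_field by auto
  have *: "dist (S (r + h) x) (S r x) < e" if "r \<in> {a..T}" "0 < h" "h < \<delta>" for r h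
  proof -
    have r: "0 \<le> r" "r \<le> T" using that assms by auto
    have "S (r + h) x - S r x = S r (S h x - x)"
      using apply_add r that by (simp add: blinfun.diff_right)
    then have "norm (S (r + h) x - S r x) \<le> K * norm (S h x - x)"
      using norm_apply_le[OF r] by (simp add: K_def)
    also have "\<dots> < K * (e / K)"
      using \<delta>(2)[OF that(2,3)] K by (intro mult_strict_left_mono) (auto simp: dist_norm)
    finally show ?thesis using K by (simp add: dist_norm)
  qed
  show "\<exists>d>0. \<forall>s\<in>{a..T}. dist s t < d \<longrightarrow> dist (S s x) (S t x) < e"
  proof (intro exI[of _ \<delta>] conjI ballI impI)
    fix s assume s: "s \<in> {a..T}" "dist s t < \<delta>"
    consider "s < t" | "s = t" | "t < s" by linarith
    then show "dist (S s x) (S t x) < e"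
    proof cases
      case 1
      then show ?thesis using *[OF s(1), of "t - s"] s by (auto simp: dist_real_def dist_commute)
    next
      case 2
      then show ?thesis using e by simp
    next
      case 3
      then show ?thesis using *[OF t, of "s - t"] s by (auto simp: dist_real_def)
    qed
  qed (rule \<delta>(1))
qed

text \<open>Orbit averages supply a dense set of domain elements that are, for fixed \<open>h\<close>, parametrised by
  a bounded operator on the whole Banach space.\<close>

definition avg :: "real \<Rightarrow> 'h \<Rightarrow> 'h" where
  "avg h x = integral {0..h} (\<lambda>r. S r x)"

lemma integrable_orbit: "a \<ge> 0 \<Longrightarrow> (\<lambda>r. S r x) integrable_on {a..b}"
  by (intro integrable_continuous_real continuous_on_orbit)

lemma bounded_linear_avg: "h \<ge> 0 \<Longrightarrow> bounded_linear (avg h)"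
proof (rule bounded_linear_intro)
  fix x y :: 'h and r :: real assume h: "h \<ge> 0"
  show "avg h (x + y) = avg h x + avg h y"
    unfolding avg_def blinfun.add_right by (intro integral_add integrable_orbit order_refl)
  show "avg h (r *\<^sub>R x) = r *\<^sub>R avg h x"
    unfolding avg_def blinfun.scaleR_right by simp
  have "norm (avg h x) \<le> growth_bound h * norm x * (h - 0)"
    unfolding avg_def using h
    by (intro integral_bound continuous_on_orbit norm_apply_le) auto
  then show "norm (avg h x) \<le> norm x * (growth_bound h * h)" by (simp add: algebra_simps)
qed

text \<open>The orbit of an average is the average of an orbit point; this turns a defect along an
  orbit into one fixed operator evaluated at the points \<open>S s x\<close>.\<close>

lemma apply_avg:
  assumes s: "s \<ge> 0"
  shows "S s (avg h x) = avg h (S s x)"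
proof -
  have "S s (avg h x) = integral {0..h} (blinfun_apply (S s) \<circ> (\<lambda>r. S r x))"
    unfolding avg_def
    by (rule integral_linear[OF integrable_orbit blinfun.bounded_linear_right, symmetric]) simp
  also have "\<dots> = avg h (S s x)"
    unfolding avg_def
  proof (rule integral_cong)
    fix r assume "r \<in> {0..h}"
    then show "(blinfun_apply (S s) \<circ> (\<lambda>r. S r x)) r = S r (S s x)"
      using apply_add[OF s, of r x] apply_add[of r s x] s by (simp add: add.commute)
  qed
  finally show ?thesis .
qed

text \<open>\<open>S \<delta>\<close> moves the window \<open>{0..h}\<close> to
  \<open>{\<delta>..h + \<delta>}\<close>. In the difference only two windows of length \<delta>
  survive, at \<open>h\<close> and at 0, and their averages tend to \<open>S h x\<close> and
  \<open>x\<close>.\<close>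

lemma avg_difference_quotient:
  assumes h: "h \<ge> 0"
  shows "((\<lambda>\<delta>. (S \<delta> (avg h x) - avg h x) /\<^sub>R \<delta>) \<longlongrightarrow> S h x - x) (at_right 0)"
proof -
  let ?f = "\<lambda>r. S r x"
  have eq: "(integral {h..h + \<delta>} ?f) /\<^sub>R \<delta> - (integral {0..0 + \<delta>} ?f) /\<^sub>R \<delta>
      = (S \<delta> (avg h x) - avg h x) /\<^sub>R \<delta>" if \<delta>: "\<delta> > 0" for \<delta>
  proof -
    have "S \<delta> (avg h x) = avg h (S \<delta> x)" using apply_avg \<delta> by simp
    also have "\<dots> = integral {0..h} (?f \<circ> (+) \<delta>)"
      unfolding avg_def
    proof (rule integral_cong)
      fix r assume "r \<in> {0..h}"
      then show "S r (S \<delta> x) = (?f \<circ> (+) \<delta>) r"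
        using apply_add[of r \<delta> x] \<delta> by (simp add: add.commute)
    qed
    also have "\<dots> = integral {\<delta>..h + \<delta>} ?f" by (simp add: integral_shift_Icc_real)
    finally have 1: "S \<delta> (avg h x) = integral {\<delta>..h + \<delta>} ?f" .
    have "integral {0..\<delta>} ?f + integral {\<delta>..h + \<delta>} ?f = integral {0..h + \<delta>} ?f"
      using \<delta> h by (intro Henstock_Kurzweil_Integration.integral_combine integrable_orbit) auto
    moreover have "integral {0..h} ?f + integral {h..h + \<delta>} ?f = integral {0..h + \<delta>} ?f"
      using \<delta> h by (intro Henstock_Kurzweil_Integration.integral_combine integrable_orbit) auto
    ultimately have "integral {h..h + \<delta>} ?f - integral {0..\<delta>} ?f = S \<delta> (avg h x) - avg h x"
      unfolding 1 by (simp add: avg_def algebra_simps)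
    then show ?thesis by (simp flip: scaleR_diff_right)
  qed
  have "((\<lambda>\<delta>. (integral {h..h + \<delta>} ?f) /\<^sub>R \<delta> - (integral {0..0 + \<delta>} ?f) /\<^sub>R \<delta>)
      \<longlongrightarrow> S h x - S 0 x) (at_right 0)"
    using h by (intro tendsto_diff integral_quotient_tendsto_right[where b="h+1"]
        integral_quotient_tendsto_right[where b=1] continuous_on_orbit) auto
  then show ?thesis
    using eq by (auto elim!: Lim_transform_eventually simp: eventually_at_right_field intro!: exI[of _ 1])
qed

text \<open>\<open>avg \<delta> x /\<^sub>R \<delta>\<close> tends to \<open>x\<close>, and by
  linearity the factor can be moved into the argument, so it is itself an average.\<close>

lemma closure_avg: "x \<in> closure {avg h y | h y. h > 0}"
proof (rule Lim_in_closed_set[OF closed_closure])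
  have "((\<lambda>\<delta>. integral {0..0 + \<delta>} (\<lambda>r. S r x) /\<^sub>R \<delta>) \<longlongrightarrow> S 0 x) (at_right 0)"
    by (intro integral_quotient_tendsto_right[where b=1] continuous_on_orbit) auto
  then show "((\<lambda>\<delta>. avg \<delta> x /\<^sub>R \<delta>) \<longlongrightarrow> x) (at_right 0)" by (simp add: avg_def)
  have "avg \<delta> x /\<^sub>R \<delta> = avg \<delta> (x /\<^sub>R \<delta>)" if "\<delta> > 0" for \<delta>
    using that bounded_linear_avg[of \<delta>] by (simp add: linear_scale bounded_linear.linear)
  then have "avg \<delta> x /\<^sub>R \<delta> \<in> {avg h y | h y. h > 0}" if "\<delta> > 0" for \<delta>
    using that by blast
  then have "avg \<delta> x /\<^sub>R \<delta> \<in> closure {avg h y | h y. h > 0}" if "\<delta> > 0" for \<delta>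
    using that closure_subset by blast
  then show "\<forall>\<^sub>F \<delta> in at_right 0. avg \<delta> x /\<^sub>R \<delta> \<in> closure {avg h y | h y. h > 0}"
    unfolding eventually_at_right_field by (intro exI[of _ 1]) simp
qed simp

end

section \<open>The generator on its domain\<close>

locale c0_semigroup_generator = bounded_c0_semigroup S M \<omega>
  for S :: "real \<Rightarrow> 'h \<Rightarrow>\<^sub>L 'h::banach" and M \<omega> :: real +
  fixes D :: "'h set" and L :: "'h \<Rightarrow> 'h"
  assumes generator: "is_generator S D L"
begin

lemma generator_tendsto: "x \<in> D \<Longrightarrow> ((\<lambda>h. (S h x - x) /\<^sub>R h) \<longlongrightarrow> L x) (at_right 0)"
  using generator by (simp add: is_generator_def)

lemma generatorI:
  assumes "((\<lambda>h. (S h x - x) /\<^sub>R h) \<longlongrightarrow> z) (at_right 0)"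
  shows "x \<in> D" and "L x = z"
proof -
  show x: "x \<in> D" using assms generator by (auto simp: is_generator_def)
  show "L x = z"
    by (rule tendsto_unique[OF _ generator_tendsto[OF x] assms]) simp
qed

text \<open>\<open>L\<close> is a bare function tied to the semigroup only on \<open>D\<close>; its
  linearity there is inherited from the difference quotients.\<close>

lemma generator_lincomb:
  assumes "x \<in> D" "y \<in> D"
  shows "x + c *\<^sub>R y \<in> D" and "L (x + c *\<^sub>R y) = L x + c *\<^sub>R L y"
proof -
  have "((\<lambda>h. (S h x - x) /\<^sub>R h + c *\<^sub>R ((S h y - y) /\<^sub>R h)) \<longlongrightarrow> L x + c *\<^sub>R L y) (at_right 0)"
    by (intro tendsto_intros generator_tendsto assms)
  then have "((\<lambda>h. (S h (x + c *\<^sub>R y) - (x + c *\<^sub>R y)) /\<^sub>R h) \<longlongrightarrow> L x + c *\<^sub>R L y) (at_right 0)"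
    by (simp add: blinfun.add_right blinfun.scaleR_right algebra_simps)
  from generatorI[OF this] show "x + c *\<^sub>R y \<in> D" and "L (x + c *\<^sub>R y) = L x + c *\<^sub>R L y" .
qed

lemma generator_zero: "0 \<in> D" "L 0 = 0"
  using generatorI[of 0 0] by simp_all

lemma generator_sum:
  assumes "finite C" "C \<subseteq> D"
  shows "(\<Sum>c\<in>C. a c *\<^sub>R c) \<in> D \<and> L (\<Sum>c\<in>C. a c *\<^sub>R c) = (\<Sum>c\<in>C. a c *\<^sub>R L c)"
  using assms
proof (induction C)
  case empty
  then show ?case by (simp add: generator_zero)
next
  case (insert d C)
  then show ?case
    using generator_lincomb[of "\<Sum>c\<in>C. a c *\<^sub>R c" d "a d"] by (simp add: add.commute)
qed

lemma avg_in_domain: "h \<ge> 0 \<Longrightarrow> avg h x \<in> D" and generator_avg: "h \<ge> 0 \<Longrightarrow> L (avg h x) = S h x - x"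
  by (auto dest: avg_difference_quotient generatorI)

text \<open>\<open>S s\<close> is continuous and commutes with the difference quotients. This lets a
  first-order expansion at time 0 be transported along the whole orbit.\<close>

lemma generator_apply:
  assumes x: "x \<in> D" and s: "s \<ge> 0"
  shows "L (S s x) = S s (L x)"
proof (rule generatorI)
  have lim: "((\<lambda>h. S s ((S h x - x) /\<^sub>R h)) \<longlongrightarrow> S s (L x)) (at_right 0)"
    by (intro tendsto_intros generator_tendsto x)
  have "S s ((S h x - x) /\<^sub>R h) = (S h (S s x) - S s x) /\<^sub>R h" if "h > 0" for h
    using apply_add[OF s, of h x] apply_add[of h s x] s that
    by (simp add: blinfun.diff_right blinfun.scaleR_right add.commute)
  with lim show "((\<lambda>h. (S h (S s x) - S s x) /\<^sub>R h) \<longlongrightarrow> S s (L x)) (at_right 0)"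
    by (auto elim!: Lim_transform_eventually simp: eventually_at_right_field intro!: exI[of _ 1])
qed

lemma first_order_expansion:
  assumes x: "x \<in> D" and e: "e > 0"
  shows "\<exists>\<delta>>0. \<forall>h. 0 < h \<longrightarrow> h < \<delta> \<longrightarrow> norm (S h x - x - h *\<^sub>R L x) \<le> h * e"
proof -
  obtain \<delta> where \<delta>: "\<delta> > 0" "\<And>h. 0 < h \<Longrightarrow> h < \<delta> \<Longrightarrow> dist ((S h x - x) /\<^sub>R h) (L x) < e"
    using tendstoD[OF generator_tendsto[OF x] e] unfolding eventually_at_right_field by auto
  have "norm (S h x - x - h *\<^sub>R L x) \<le> h * e" if h: "0 < h" "h < \<delta>" for h
  proof -
    have "S h x - x - h *\<^sub>R L x = h *\<^sub>R ((S h x - x) /\<^sub>R h - L x)"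
      using h by (simp add: scaleR_diff_right)
    then show ?thesis using \<delta>(2)[OF h] h by (simp add: dist_norm)
  qed
  with \<delta>(1) show ?thesis by blast
qed

end

section \<open>Consistency of the Galerkin generators and the Trotter-Kato theorem\<close>

text \<open>\<open>SN_flow\<close> identifies the extended semigroup with the exponential only on
  \<open>H N\<close>. Comparisons with \<open>S\<close> are therefore made for
  \<open>SN N t (P N x)\<close>.\<close>

locale galerkin_scheme = c0_semigroup_generator S M \<omega> D L
  for S :: "real \<Rightarrow> 'h \<Rightarrow>\<^sub>L 'h::{real_inner, banach}" and M \<omega> :: real and D L +
  fixes H :: "nat \<Rightarrow> 'h set" and P :: "nat \<Rightarrow> 'h \<Rightarrow> 'h" and SN :: "nat \<Rightarrow> real \<Rightarrow> 'h \<Rightarrow>\<^sub>L 'h"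
  assumes finite_dim: "N \<ge> 1 \<Longrightarrow> \<exists>B. finite B \<and> H N = span B"
    and H_domain: "N \<ge> 1 \<Longrightarrow> H N \<subseteq> D"
    and projector: "N \<ge> 1 \<Longrightarrow> is_orthogonal_projector (H N) (P N)"
    and projector_tendsto: "(\<lambda>N. norm (P N x - x)) \<longlonglongrightarrow> 0"
    and SN_semigroup: "N \<ge> 1 \<Longrightarrow> c0_semigroup (SN N)"
    and SN_flow: "N \<ge> 1 \<Longrightarrow> t \<ge> 0 \<Longrightarrow> z \<in> H N \<Longrightarrow> SN N t z = exp_flow (galerkin_op (P N) L) t z"
    and SN_growth: "N \<ge> 1 \<Longrightarrow> t \<ge> 0 \<Longrightarrow> norm (SN N t) \<le> M * exp (\<omega> * t)"
    and consistency: "\<phi> \<in> D \<Longrightarrow> (\<lambda>N. norm (galerkin_op (P N) L \<phi> - L \<phi>)) \<longlonglongrightarrow> 0"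
begin

lemma SN_bounded_c0_semigroup: "N \<ge> 1 \<Longrightarrow> bounded_c0_semigroup (SN N) M \<omega>"
  by unfold_locales (auto intro: SN_semigroup SN_growth M_ge_1 omega_nonneg)

lemma norm_SN_le: "N \<ge> 1 \<Longrightarrow> 0 \<le> t \<Longrightarrow> t \<le> T \<Longrightarrow> norm (SN N t x) \<le> growth_bound T * norm x"
  using bounded_c0_semigroup.norm_apply_le[OF SN_bounded_c0_semigroup]
  by (simp add: growth_bound_def bounded_c0_semigroup.growth_bound_def[OF SN_bounded_c0_semigroup])

lemma bounded_linear_projector: "N \<ge> 1 \<Longrightarrow> bounded_linear (P N)"
  using finite_dim projector bounded_linear_orthogonal_projector by metis

lemma norm_projector_le: "N \<ge> 1 \<Longrightarrow> norm (P N x) \<le> norm x"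
  using projector orthogonal_projector_norm_le by blast

lemma projector_in: "N \<ge> 1 \<Longrightarrow> P N x \<in> H N"
  using projector by (simp add: is_orthogonal_projector_def)

lemma projector_idem: "N \<ge> 1 \<Longrightarrow> P N (P N x) = P N x"
  using orthogonal_projector_fixes[OF projector _ projector_in] finite_dim subspace_span by metis

text \<open>\<open>L\<close> may be unbounded, but after \<open>P N\<close> it acts only on finitely
  many fixed vectors of \<open>D\<close> with coefficients linear and bounded in
  \<open>x\<close>.\<close>

lemma bounded_linear_galerkin_op:
  assumes N: "N \<ge> 1"
  shows "bounded_linear (galerkin_op (P N) L)"
proof -
  obtain B where B: "finite B" "H N = span B" using finite_dim[OF N] by blast
  obtain C where C: "finite C" "span C = span B" "pairwise orthogonal C"
    using basis_orthogonal[OF B(1)] by blast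
  have CD: "C \<subseteq> D" using H_domain[OF N] B C span_superset by blast
  have eq: "L (P N x) = (\<Sum>c\<in>C. (inner x c / inner c c) *\<^sub>R L c)" for x
    using orthogonal_projector_formula[OF _ C(1,3), of "P N" x] projector[OF N] B C
      generator_sum[OF C(1) CD] by simp
  have "bounded_linear (\<lambda>x. L (P N x))"
    unfolding eq divide_inverse
    by (intro bounded_linear_sum bounded_linear_scaleR_const bounded_linear_mult_const
        bounded_linear_inner_left)
  from bounded_linear_compose[OF bounded_linear_projector[OF N] this]
  show ?thesis unfolding galerkin_op_def .
qed

lemma galerkin_op_projector: "N \<ge> 1 \<Longrightarrow> galerkin_op (P N) L (P N x) = galerkin_op (P N) L x"
  by (simp add: galerkin_op_def projector_idem)

text \<open>The discrete form of Duhamel's formula: the increments of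
  \<open>s \<mapsto> SN N (t - s) (P N (S s \<phi>))\<close> measure the defect of the generators along the orbit.\<close>

lemma semigroup_error_le:
  assumes N: "N \<ge> 1" and \<phi>: "\<phi> \<in> D" and t: "0 \<le> t" "t \<le> T"
    and b: "\<And>s. s \<in> {0..t} \<Longrightarrow> norm (P N (L (S s \<phi>)) - galerkin_op (P N) L (S s \<phi>)) \<le> b"
  shows "norm (P N (S t \<phi>) - SN N t (P N \<phi>)) \<le> t * (growth_bound T * b)"
proof -
  interpret SN: bounded_c0_semigroup "SN N" M \<omega> by (rule SN_bounded_c0_semigroup[OF N])
  interpret P: bounded_linear "P N" by (rule bounded_linear_projector[OF N])
  let ?A = "galerkin_op (P N) L"
  obtain a where a: "a \<ge> 0" "\<And>x. norm (?A x) \<le> a * norm x"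
    using bounded_linear.nonneg_bounded[OF bounded_linear_galerkin_op[OF N]] by (auto simp: mult.commute)
  define K where "K = growth_bound T"
  have K: "K \<ge> 1" using growth_bound_ge_1 t by (simp add: K_def)
  define g where "g s = SN N (t - s) (P N (S s \<phi>))" for s
  have "norm (g t - g 0) \<le> t * (K * b)"
  proof (rule norm_increment_le_if_uniform_quotient_le[OF t(1)])
    fix e :: real assume e: "e > 0"
    \<comment> \<open>Constant of the quadratic remainder of the exponential: one \<open>K\<close>
      for the outer \<open>SN N\<close>, one for the bound of the orbit point
      \<open>w\<close>.\<close>
    define c where "c = K * (exp a * (K * norm \<phi>))"
    have c: "c \<ge> 0" using K by (simp add: c_def)
    \<comment> \<open>The expansion error at \<phi> passes through \<open>S s\<close> and through
      \<open>SN N\<close>, each costing a factor \<open>K\<close>; what arrives is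
      \<open>e/2\<close>.\<close>
    have "e / (2 * K * K) > 0" using e K by simp
    then obtain \<delta>1 where \<delta>1: "\<delta>1 > 0"
      "\<And>h. 0 < h \<Longrightarrow> h < \<delta>1 \<Longrightarrow> norm (S h \<phi> - \<phi> - h *\<^sub>R L \<phi>) \<le> h * (e / (2 * K * K))"
      using first_order_expansion[OF \<phi>] by blast
    define \<delta> where "\<delta> = Min {\<delta>1, 1, e / (2 * (c + 1))}"
    have \<delta>: "\<delta> > 0" "\<delta> \<le> \<delta>1" "\<delta> \<le> 1" "\<delta> \<le> e / (2 * (c + 1))"
      using \<delta>1(1) e c by (auto simp: \<delta>_def)
    have "norm (g (s + h) - g s) \<le> h * (K * b + e)"
      if s: "0 \<le> s" and h: "0 < h" "h < \<delta>" and sh: "s + h \<le> t" for s h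
    proof -
      define w where "w = S s \<phi>"
      have w: "norm w \<le> K * norm \<phi>" unfolding w_def K_def using s h sh t by (intro norm_apply_le) auto
      have Ssh: "S (s + h) \<phi> = S h w"
        using apply_add[of h s \<phi>] s h by (simp add: w_def add.commute)
      have SNsh: "SN N (t - s) z = SN N (t - (s + h)) (SN N h z)" for z
        using SN.apply_add[of "t - (s + h)" h z] h sh by simp
      have "g (s + h) - g s = SN N (t - (s + h)) (P N (S h w) - SN N h (P N w))"
        unfolding g_def Ssh SNsh w_def[symmetric] by (simp add: blinfun.diff_right)
      then have "norm (g (s + h) - g s) \<le> K * norm (P N (S h w) - SN N h (P N w))"
        unfolding K_def using norm_SN_le[OF N, of "t - (s + h)" T] s h sh t by simp
      \<comment> \<open>Expand both flows to first order: the projected remainder of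
        \<open>S h\<close> at \<open>w\<close>, minus the remainder of the exponential at
        \<open>P N w\<close>, plus \<open>h\<close> times the generator defect. The zeroth-order
        terms cancel.\<close>
      also have "P N (S h w) - SN N h (P N w) =
          P N (S h w - w - h *\<^sub>R L w) - (exp_flow ?A h (P N w) - P N w - h *\<^sub>R ?A (P N w))
          + h *\<^sub>R (P N (L w) - ?A w)" (is "_ = ?u - ?v + ?z")
        using SN_flow[OF N _ projector_in[OF N], of h w] h
        by (simp add: galerkin_op_projector[OF N] P.diff P.add P.scaleR scaleR_diff_right)
      also have "K * norm (?u - ?v + ?z) \<le>
          K * (K * (h * (e / (2 * K * K))) + h * (h * (exp a * (K * norm \<phi>))) + h * b)"
      proof (rule mult_left_mono)
        \<comment> \<open>The remainder at \<open>w\<close> is the image under \<open>S s\<close> of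
          the one at \<phi>; hence the threshold \<open>\<delta>1\<close> does not depend on
          \<open>s\<close>.\<close>
        have "S h w - w - h *\<^sub>R L w = S s (S h \<phi> - \<phi> - h *\<^sub>R L \<phi>)"
          using Ssh apply_add[of s h \<phi>] generator_apply[OF \<phi> s] s h
          by (simp add: w_def blinfun.diff_right blinfun.scaleR_right)
        then have "norm ?u \<le> norm (S s (S h \<phi> - \<phi> - h *\<^sub>R L \<phi>))"
          using norm_projector_le[OF N] by metis
        also have "\<dots> \<le> K * norm (S h \<phi> - \<phi> - h *\<^sub>R L \<phi>)"
          unfolding K_def using s h sh t by (intro norm_apply_le) auto
        also have "\<dots> \<le> K * (h * (e / (2 * K * K)))"
          using \<delta>1(2)[of h] h \<delta> K by (intro mult_left_mono) auto
        finally have u: "norm ?u \<le> K * (h * (e / (2 * K * K)))" .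
        have "norm ?v \<le> h\<^sup>2 * exp a * norm (P N w)"
          using h \<delta> by (intro exp_flow_first_order a) auto
        also have "\<dots> \<le> h\<^sup>2 * exp a * (K * norm \<phi>)"
          using norm_projector_le[OF N, of w] w by (intro mult_left_mono) auto
        finally have v: "norm ?v \<le> h * (h * (exp a * (K * norm \<phi>)))"
          by (simp add: power2_eq_square mult.assoc)
        have "norm ?z \<le> h * b"
          using b[of s] s h sh by (simp add: w_def)
        with u v show "norm (?u - ?v + ?z) \<le> K * (h * (e / (2 * K * K))) + h * (h * (exp a * (K * norm \<phi>))) + h * b"
          using norm_triangle_ineq[of "?u - ?v" ?z] norm_triangle_ineq4[of ?u ?v] by linarith
      qed (use K in simp)
      also have "\<dots> = h * (K * b + e / 2 + h * c)"
        using K by (simp add: c_def field_simps)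
      also have "\<dots> \<le> h * (K * b + e)"
      proof (rule mult_left_mono)
        have "h * c \<le> e / (2 * (c + 1)) * (c + 1)"
          using h \<delta> c by (intro mult_mono) auto
        also have "\<dots> = e / 2" using c by (simp add: field_simps)
        finally show "K * b + e / 2 + h * c \<le> K * b + e" by simp
      qed (use h in simp)
      finally show ?thesis .
    qed
    then show "\<exists>\<delta>>0. \<forall>s h. 0 \<le> s \<longrightarrow> 0 < h \<longrightarrow> s + h \<le> t \<longrightarrow> h < \<delta> \<longrightarrow>
        norm (g (s + h) - g s) \<le> h * (K * b + e)"
      using \<delta>(1) by blast
  qed
  then show ?thesis by (simp add: g_def K_def)
qed

lemma projector_uniform_on_compact:
  assumes X: "compact X" and e: "e > 0"
  shows "\<forall>\<^sub>F N in sequentially. \<forall>x\<in>X. norm (P N x - x) < e"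
proof -
  \<comment> \<open>There is no time parameter here, so the index set is a single point.\<close>
  have "\<forall>\<^sub>F N in sequentially. \<forall>i::unit\<in>UNIV. \<forall>x\<in>X. norm (P N x - x) < e"
  proof (rule uniform_on_compact[OF _ _ X e, where K = 2 and d = "\<lambda>N i x. P N x - x"])
    show "\<forall>\<^sub>F N in sequentially. \<forall>i::unit\<in>UNIV. \<forall>x y. norm (P N x - x - (P N y - y)) \<le> 2 * dist x y"
      using eventually_ge_at_top[of 1]
    proof eventually_elim
      case (elim N)
      have "norm (P N x - x - (P N y - y)) \<le> 2 * dist x y" for x y
      proof -
        have "P N x - x - (P N y - y) = P N (x - y) - (x - y)"
          using bounded_linear_projector[OF elim] by (simp add: linear_diff bounded_linear.linear)
        also have "norm \<dots> \<le> norm (P N (x - y)) + norm (x - y)" by (rule norm_triangle_ineq4)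
        also have "\<dots> \<le> 2 * dist x y" using norm_projector_le[OF elim, of "x - y"] by (simp add: dist_norm)
        finally show ?thesis .
      qed
      then show ?case by blast
    qed
    show "\<forall>\<^sub>F N in sequentially. \<forall>i::unit\<in>UNIV. norm (P N x - x) < e'" if "e' > 0" for x e'
      using order_tendstoD(2)[OF projector_tendsto that] by simp
  qed
  then show ?thesis by simp
qed

lemma generator_error_on_orbit:
  assumes h: "h \<ge> 0" and e: "e > 0" and T: "T \<ge> 0"
  shows "\<forall>\<^sub>F N in sequentially. \<forall>s\<in>{0..T}.
           norm (P N (L (S s (avg h x))) - galerkin_op (P N) L (S s (avg h x))) < e"
proof -
  \<comment> \<open>On \<open>avg h z\<close> the term \<open>L\<close> becomes
    \<open>S h z - z\<close>, which makes \<open>d N\<close> a bounded operator on the whole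
    space.\<close>
  define d where "d N z = P N (S h z - z) - galerkin_op (P N) L (avg h z)" for N z
  have d_linear: "bounded_linear (d N)" if N: "N \<ge> 1" for N
    unfolding d_def
    by (intro bounded_linear_sub bounded_linear_compose[OF bounded_linear_projector[OF N]]
        bounded_linear_compose[OF bounded_linear_galerkin_op[OF N]] bounded_linear_avg h
        blinfun.bounded_linear_right bounded_linear_ident)
  have d_lim: "(\<lambda>N. d N z) \<longlonglongrightarrow> 0" for z
  proof -
    have "(\<lambda>N. P N (S h z - z) - (S h z - z)) \<longlonglongrightarrow> 0"
      using projector_tendsto by (simp add: tendsto_norm_zero_iff)
    moreover have "(\<lambda>N. galerkin_op (P N) L (avg h z) - L (avg h z)) \<longlonglongrightarrow> 0"
      using consistency[OF avg_in_domain[OF h]] by (simp add: tendsto_norm_zero_iff)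
    ultimately show ?thesis
      using tendsto_diff by (fastforce simp: d_def generator_avg[OF h])
  qed
  \<comment> \<open>The sequence starts at \<open>Suc n\<close> because nothing is known about
    \<open>P 0\<close>.\<close>
  have "\<exists>K. \<forall>n z. norm (d (Suc n) z) \<le> K * norm z"
    using d_linear LIMSEQ_Suc[OF d_lim]
    by (intro uniform_boundedness_principle) (auto intro: convergent_imp_bounded)
  then obtain K where K: "norm (d (Suc n) z) \<le> K * norm z" for n z by blast
  have orbit: "compact ((\<lambda>s. S s x) ` {0..T})"
    by (intro compact_continuous_image continuous_on_orbit) auto
  have "\<forall>\<^sub>F N in sequentially. \<forall>i::unit\<in>UNIV. \<forall>z\<in>(\<lambda>s. S s x) ` {0..T}. norm (d N z) < e"
  proof (rule uniform_on_compact[OF _ _ orbit e, where K = K and d = "\<lambda>N i. d N"])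
    show "\<forall>\<^sub>F N in sequentially. \<forall>i::unit\<in>UNIV. \<forall>x y. norm (d N x - d N y) \<le> K * dist x y"
      using eventually_ge_at_top[of 1]
    proof eventually_elim
      case (elim N)
      then obtain n where n: "N = Suc n" by (cases N) auto
      have "norm (d N x - d N y) \<le> K * dist x y" for x y
        using d_linear[OF elim] K[of n "x - y"]
        by (simp add: n dist_norm linear_diff[symmetric] bounded_linear.linear)
      then show ?case by blast
    qed
    show "\<forall>\<^sub>F N in sequentially. \<forall>i::unit\<in>UNIV. norm (d N z) < e'" if "e' > 0" for z e'
      using tendstoD[OF d_lim that] by (simp add: dist_norm)
  qed
  then show ?thesis
    by eventually_elim (auto simp: d_def apply_avg generator_avg[OF h])
qed

text \<open>The maps \<open>x \<mapsto> SN N t (P N x) - S t x\<close> share the Lipschitz constant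
  \<open>2 * K\<close>, so it suffices to treat the dense set of averages. There the error splits
  into a projection error along a compact orbit and the accumulated generator defect.\<close>

theorem trotter_kato:
  assumes T: "T \<ge> 0" and X: "compact X" and e: "e > 0"
  shows "\<forall>\<^sub>F N in sequentially. \<forall>t\<in>{0..T}. \<forall>x\<in>X. norm (SN N t (P N x) - S t x) < e"
proof -
  define K where "K = growth_bound T"
  have K: "K \<ge> 1" using growth_bound_ge_1 T by (simp add: K_def)
  have lip: "\<forall>\<^sub>F N in sequentially. \<forall>t\<in>{0..T}. \<forall>x y.
      norm (SN N t (P N x) - S t x - (SN N t (P N y) - S t y)) \<le> (2 * K) * dist x y"
    using eventually_ge_at_top[of 1]
  proof eventually_elim
    case (elim N)
    have "norm (SN N t (P N x) - S t x - (SN N t (P N y) - S t y)) \<le> 2 * K * dist x y"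
      if t: "t \<in> {0..T}" for t x y
    proof -
      have "SN N t (P N x) - S t x - (SN N t (P N y) - S t y) = SN N t (P N (x - y)) - S t (x - y)"
        using bounded_linear_projector[OF elim]
        by (simp add: linear_diff bounded_linear.linear blinfun.diff_right)
      moreover have "norm (SN N t (P N (x - y))) \<le> K * norm (P N (x - y))"
        unfolding K_def using t by (intro norm_SN_le elim) auto
      moreover have "K * norm (P N (x - y)) \<le> K * norm (x - y)"
        using K norm_projector_le[OF elim] by (intro mult_left_mono) auto
      moreover have "norm (S t (x - y)) \<le> K * norm (x - y)"
        unfolding K_def using t by (intro norm_apply_le) auto
      ultimately show ?thesis
        using norm_triangle_ineq4[of "SN N t (P N (x - y))" "S t (x - y)"] by (simp add: dist_norm)
    qed
    then show ?case by blast
  qed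
  have dense: "\<forall>\<^sub>F N in sequentially. \<forall>t\<in>{0..T}. norm (SN N t (P N \<phi>) - S t \<phi>) < e'"
    if \<phi>: "\<phi> \<in> {avg h y | h y. h > 0}" and e': "e' > 0" for \<phi> e'
  proof -
    obtain h y where h: "h > 0" "\<phi> = avg h y" using \<phi> by blast
    \<comment> \<open>Chosen so that \<open>(T + 1) * (K * b) = e' / 2\<close>; the other half goes
      to the projection error.\<close>
    define b where "b = e' / (2 * K * (T + 1))"
    have b: "b > 0" using e' K T by (simp add: b_def)
    have "compact ((\<lambda>s. S s \<phi>) ` {0..T})"
      by (intro compact_continuous_image continuous_on_orbit) auto
    from projector_uniform_on_compact[OF this, of "e' / 2"] e'
    have "\<forall>\<^sub>F N in sequentially. \<forall>t\<in>{0..T}. norm (P N (S t \<phi>) - S t \<phi>) < e' / 2" by simp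
    moreover have "\<forall>\<^sub>F N in sequentially. \<forall>s\<in>{0..T}.
        norm (P N (L (S s \<phi>)) - galerkin_op (P N) L (S s \<phi>)) < b"
      using generator_error_on_orbit[of h b T y] h b T by simp
    ultimately show ?thesis using eventually_ge_at_top[of 1]
    proof eventually_elim
      case (elim N)
      show ?case
      proof
        fix t assume t: "t \<in> {0..T}"
        have "norm (P N (S t \<phi>) - SN N t (P N \<phi>)) \<le> t * (growth_bound T * b)"
        proof (rule semigroup_error_le)
          show "\<phi> \<in> D" using h avg_in_domain by simp
          show "norm (P N (L (S s \<phi>)) - galerkin_op (P N) L (S s \<phi>)) \<le> b" if "s \<in> {0..t}" for s
            using elim(2) that t by (meson atLeastAtMost_iff less_imp_le order_trans)
        qed (use elim t in auto)
        also have "\<dots> \<le> (T + 1) * (K * b)"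
          unfolding K_def using t K b by (intro mult_right_mono) (auto simp: K_def)
        also have "\<dots> = e' / 2" using K T by (simp add: b_def divide_simps)
        finally show "norm (SN N t (P N \<phi>) - S t \<phi>) < e'"
          using elim(1) t norm_triangle_ineq[of "SN N t (P N \<phi>) - P N (S t \<phi>)" "P N (S t \<phi>) - S t \<phi>"]
            norm_minus_commute[of "SN N t (P N \<phi>)" "P N (S t \<phi>)"] by fastforce
      qed
    qed
  qed
  have ptw: "\<forall>\<^sub>F N in sequentially. \<forall>t\<in>{0..T}. norm (SN N t (P N x) - S t x) < e'" if "e' > 0" for x e'
    by (rule uniform_from_dense[OF lip dense closure_avg that])
  show ?thesis
    by (rule uniform_on_compact[OF lip ptw X e])
qed

end

section \<open>Translation in time\<close>

lemma lebesgue_translation: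
  fixes t :: real
  shows "(+) t \<in> lebesgue \<rightarrow>\<^sub>M lebesgue" and "distr lebesgue lebesgue ((+) t) = lebesgue"
proof -
  have "(\<lambda>x. t + 1 * x) = (+) t" by auto
  then show "(+) t \<in> lebesgue \<rightarrow>\<^sub>M lebesgue"
    using lebesgue_affine_measurable[where c = "\<lambda>_::real. 1" and t = t] by simp
  have "density (distr lebesgue lebesgue ((+) t)) (\<lambda>_. 1) = lebesgue"
    using lebesgue_real_affine[of 1 t] \<open>(\<lambda>x. t + 1 * x) = (+) t\<close> by simp
  then show "distr lebesgue lebesgue ((+) t) = lebesgue" by (simp add: density_1)
qed

lemma integrable_lebesgue_translate:
  fixes f :: "real \<Rightarrow> 'a::{banach, second_countable_topology}"
  assumes "integrable lebesgue f"
  shows "integrable lebesgue (\<lambda>x. f (t + x))"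
  using integrable_distr[OF lebesgue_translation(1)[of t], where f = f] assms
  by (simp add: lebesgue_translation(2))

lemma integral_lebesgue_translate:
  fixes f :: "real \<Rightarrow> 'a::{banach, second_countable_topology}"
  assumes "integrable lebesgue f"
  shows "integral\<^sup>L lebesgue (\<lambda>x. f (t + x)) = integral\<^sup>L lebesgue f"
  using integral_distr[OF lebesgue_translation(1)[of t] borel_measurable_integrable[OF assms]]
  by (simp add: lebesgue_translation(2))

lemma set_integral_lebesgue_translate:
  fixes f :: "real \<Rightarrow> 'a::{banach, second_countable_topology}"
  assumes f: "set_integrable lebesgue {a..b} f"
    and g: "\<And>x. x \<in> {a + t..b + t} \<Longrightarrow> g x = f (x - t)"
  shows "set_integrable lebesgue {a + t..b + t} g"
    and "(LINT x:{a + t..b + t}|lebesgue. g x) = (LINT x:{a..b}|lebesgue. f x)"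
proof -
  have eq: "(\<lambda>x. indicator {a + t..b + t} x *\<^sub>R g x) = (\<lambda>x. indicator {a..b} (- t + x) *\<^sub>R f (- t + x))"
  proof
    fix x
    show "indicator {a + t..b + t} x *\<^sub>R g x = indicator {a..b} (- t + x) *\<^sub>R f (- t + x)"
      using g[of x] by (cases "x \<in> {a + t..b + t}") (auto simp: indicator_def algebra_simps)
  qed
  show "set_integrable lebesgue {a + t..b + t} g"
    using integrable_lebesgue_translate[OF f[unfolded set_integrable_def], of "- t"]
    unfolding set_integrable_def eq .
  show "(LINT x:{a + t..b + t}|lebesgue. g x) = (LINT x:{a..b}|lebesgue. f x)"
    using integral_lebesgue_translate[OF f[unfolded set_integrable_def], of "- t"]
    unfolding set_lebesgue_integral_def eq .
qed

text \<open>Time enters the formula only through differences and the control, so substitution in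
  both integrals suffices. \<open>d\<close> may be negative, and \<open>T'\<close> may cut the
  solution short; shifting forth and back uses both.\<close>

lemma voc_solution_translate:
  assumes y: "voc_solution E G B t T x u y" and T': "T' \<le> T + d"
    and v: "\<And>r. r \<in> {t + d..T'} \<Longrightarrow> v r = u (r - d)"
  shows "voc_solution E G B (t + d) T' x v (restrict (\<lambda>r. y (r - d)) {t + d..T'})"
proof -
  define z where "z = restrict (\<lambda>r. y (r - d)) {t + d..T'}"
  have z: "z r = y (r - d)" if "r \<in> {t + d..T'}" for r using that by (simp add: z_def)
  have "continuous_on {t + d..T'} (\<lambda>r. y (r - d))"
  proof (rule continuous_on_compose2[of "{t..T}" y])
    show "continuous_on {t..T} y" using y by (simp add: voc_solution_def)
  qed (use T' in \<open>auto intro!: continuous_on_diff continuous_on_id continuous_on_const\<close>)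
  then have cont: "continuous_on {t + d..T'} z"
    by (rule continuous_on_eq) (simp add: z)
  have voc: "set_integrable lebesgue {t + d..s} (\<lambda>r. E (s - r) (G (z r))) \<and>
      set_integrable lebesgue {t + d..s} (\<lambda>r. E (s - r) (B (v r))) \<and>
      z s = E (s - (t + d)) x + (LINT r:{t + d..s}|lebesgue. E (s - r) (G (z r)))
        + (LINT r:{t + d..s}|lebesgue. E (s - r) (B (v r)))"
    if s: "s \<in> {t + d..T'}" for s
  proof -
    let ?f = "\<lambda>r. E (s - d - r) (G (y r))" and ?g = "\<lambda>r. E (s - d - r) (B (u r))"
    have sd: "s - d \<in> {t..T}" using s T' by auto
    have fg: "set_integrable lebesgue {t..s - d} ?f" "set_integrable lebesgue {t..s - d} ?g"
      "y (s - d) = E (s - d - t) x + (LINT r:{t..s - d}|lebesgue. ?f r) + (LINT r:{t..s - d}|lebesgue. ?g r)"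
      using y[unfolded voc_solution_def, THEN conjunct2, THEN conjunct2, THEN bspec, OF sd]
      by blast+
    have 1: "E (s - r) (G (z r)) = ?f (r - d)" "E (s - r) (B (v r)) = ?g (r - d)"
      if "r \<in> {t + d..s - d + d}" for r
      using that s by (simp_all add: z v)
    note F = set_integral_lebesgue_translate[where t = d and g = "\<lambda>r. E (s - r) (G (z r))", OF fg(1) 1(1)]
    note G = set_integral_lebesgue_translate[where t = d and g = "\<lambda>r. E (s - r) (B (v r))", OF fg(2) 1(2)]
    have shift: "s - d + d = s" "s - d - t = s - (t + d)" by simp_all
    show ?thesis
    proof (intro conjI)
      show "set_integrable lebesgue {t + d..s} (\<lambda>r. E (s - r) (G (z r)))"
        using F(1) unfolding shift .
      show "set_integrable lebesgue {t + d..s} (\<lambda>r. E (s - r) (B (v r)))"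
        using G(1) unfolding shift .
      show "z s = E (s - (t + d)) x + (LINT r:{t + d..s}|lebesgue. E (s - r) (G (z r)))
          + (LINT r:{t + d..s}|lebesgue. E (s - r) (B (v r)))"
        using fg(3) F(2) G(2) unfolding shift z[OF s] by metis
    qed
  qed
  have "z \<in> extensional {t + d..T'}" by (simp add: z_def)
  then show ?thesis
    unfolding voc_solution_def z_def[symmetric] by (intro conjI ballI cont voc)
qed

text \<open>Existence on \<open>{t..T}\<close> comes from shifting the solution on the full horizon
  \<open>T\<close>, so bounds for that horizon apply. Uniqueness comes from shifting back to the
  horizon \<open>T - t\<close>.\<close>

lemma the_voc_solution_translate:
  assumes t: "0 \<le> t" "t \<le> T" and w: "\<And>r. r \<in> {t..T} \<Longrightarrow> w r = v (r - t)"
    and ex: "\<exists>!y. voc_solution E G B 0 T x v y"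
    and uniq: "t < T \<Longrightarrow> \<exists>!y. voc_solution E G B 0 (T - t) x v y"
    and s: "s \<in> {t..T}"
  shows "(THE y. voc_solution E G B t T x w y) s = (THE y. voc_solution E G B 0 T x v y) (s - t)"
proof -
  define y where "y = (THE y. voc_solution E G B 0 T x v y)"
  have y: "voc_solution E G B 0 T x v y" unfolding y_def by (rule theI'[OF ex])
  define z where "z = restrict (\<lambda>r. y (r - t)) {t..T}"
  have z: "voc_solution E G B t T x w z"
    using voc_solution_translate[OF y, of T t w] w t by (simp add: z_def)
  have "(THE z. voc_solution E G B t T x w z) = z"
  proof (rule the_equality)
    show "voc_solution E G B t T x w z" by (rule z)
    fix z' assume z': "voc_solution E G B t T x w z'"
    show "z' = z"
    proof (cases "t < T")
      \<comment> \<open>Uniqueness is available only on intervals of positive length; at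
        \<open>t = T\<close> the formula itself fixes the single value.\<close>
      case False
      then have "t = T" using t by simp
      then have "z' \<in> extensional {T}" "z \<in> extensional {T}" "z' T = z T"
        using z z' by (simp_all add: voc_solution_degenerate)
      then show ?thesis by (intro extensionalityI[of z' "{T}"]) auto
    next
      case True
      have shift_back: "voc_solution E G B 0 (T - t) x v (restrict (\<lambda>r. f (r + t)) {0..T - t})"
        if "voc_solution E G B t T x w f" for f
        using voc_solution_translate[OF that, of "T - t" "- t" v] w by simp
      have eq: "restrict (\<lambda>r. z' (r + t)) {0..T - t} = restrict (\<lambda>r. z (r + t)) {0..T - t}"
      proof (rule trans[OF sym])
        show "(THE y. voc_solution E G B 0 (T - t) x v y) = restrict (\<lambda>r. z' (r + t)) {0..T - t}"
          by (rule the1_equality) (fact uniq[OF True], rule shift_back[OF z'])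
        show "(THE y. voc_solution E G B 0 (T - t) x v y) = restrict (\<lambda>r. z (r + t)) {0..T - t}"
          by (rule the1_equality) (fact uniq[OF True], rule shift_back[OF z])
      qed
      show ?thesis
      proof (rule extensionalityI[of z' "{t..T}"])
        show "z' \<in> extensional {t..T}" "z \<in> extensional {t..T}"
          using z z' by (simp_all add: voc_solution_def)
        fix r assume "r \<in> {t..T}"
        then have "r - t \<in> {0..T - t}" by auto
        then show "z' r = z r" using fun_cong[OF eq, of "r - t"] by simp
      qed
    qed
  qed
  then show ?thesis using s by (simp add: z_def y_def)
qed

lemma admissible_AE:
  assumes "u \<in> admissible q U T"
  shows "AE r in lebesgue. r \<in> {0..T} \<longrightarrow> u r \<in> U"
  using assms by (simp add: admissible_def AE_restrict_space_iff)

text \<open>Provides the filler value with which shifted controls are continued; an interval of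
  positive measure cannot be mapped almost everywhere into the empty set.\<close>

lemma admissible_imp_nonempty:
  assumes "u \<in> admissible q U T" and "T > 0"
  shows "U \<noteq> {}"
proof
  assume "U = {}"
  then have "AE r in lebesgue. r \<notin> {0..T}" using admissible_AE[OF assms(1)] by simp
  then have "{0..T} \<in> null_sets lebesgue" by (subst AE_iff_null_sets) auto
  then show False using \<open>T > 0\<close> by (auto simp: null_sets_def)
qed

text \<open>Filling with \<open>c\<close> keeps the values in \<open>U\<close> on any horizon
  \<open>T'\<close>, and boundedness of \<open>U\<close> gives the integrability of the power
  \<open>q\<close>.\<close>

lemma admissible_translate:
  assumes u: "u \<in> admissible q U T" and U: "bounded U" and c: "c \<in> U" and t: "0 \<le> t" and q: "q \<ge> 0"
  shows "(\<lambda>r. if r + t \<le> T then u (r + t) else c) \<in> admissible q U T'"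
proof -
  \<comment> \<open>Outside \<open>{0..T}\<close> nothing is known about \<open>u\<close>, not even
    measurability; overwriting it there gives a function on the whole line that can be
    translated.\<close>
  define u' where "u' r = (if r \<in> {0..T} then u r else c)" for r
  define v where "v r = u' (t + r)" for r
  have "u' \<in> borel_measurable lebesgue"
    using u unfolding admissible_def u'_def
    by (subst (asm) measurable_restrict_space_iff[where c = c]) auto
  from measurable_compose[OF lebesgue_translation(1) this]
  have v_meas: "v \<in> borel_measurable lebesgue" by (simp add: v_def[abs_def])
  have "AE r in lebesgue. u' r \<in> U"
    using admissible_AE[OF u] by eventually_elim (use c in \<open>auto simp: u'_def\<close>)
  then have "AE r in distr lebesgue lebesgue ((+) t). u' r \<in> U"
    unfolding lebesgue_translation(2) .
  from AE_distrD[OF lebesgue_translation(1) this] have v_AE: "AE r in lebesgue. v r \<in> U"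
    by (simp add: v_def)
  obtain b where b: "\<And>z. z \<in> U \<Longrightarrow> norm z \<le> b" using U by (auto simp: bounded_iff)
  let ?M = "lebesgue_on {0..T'}"
  have v_meas': "v \<in> borel_measurable ?M" using v_meas by (rule measurable_restrict_space1)
  have v_AE': "AE r in ?M. v r \<in> U" using v_AE by (auto simp: AE_restrict_space_iff)
  have "integrable ?M (\<lambda>r. norm (v r) powr q)"
  proof (rule integrableI_bounded_set[where A = "{0..T'}" and B = "b powr q"])
    show "emeasure ?M {0..T'} < \<infinity>" by (simp add: emeasure_restrict_space emeasure_lborel_Icc_eq)
    show "AE r in ?M. r \<in> {0..T'} \<longrightarrow> norm (norm (v r) powr q) \<le> b powr q"
      using v_AE' by eventually_elim (use b q in \<open>auto intro: powr_mono2\<close>)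
  qed (use v_meas' in auto)
  then have "v \<in> admissible q U T'" using v_meas' v_AE' by (simp add: admissible_def)
  \<comment> \<open>For \<open>r < - t\<close> the two functions may differ, so the three conditions
    are transferred by congruence on \<open>{0..T'}\<close>.\<close>
  moreover have eq: "(if r + t \<le> T then u (r + t) else c) = v r" if "r \<in> {0..T'}" for r
    using that t by (auto simp: v_def u'_def add.commute)
  moreover have "(\<lambda>r. if r + t \<le> T then u (r + t) else c) \<in> borel_measurable ?M \<longleftrightarrow> v \<in> borel_measurable ?M"
    using eq by (intro measurable_cong) auto
  moreover have "integrable ?M (\<lambda>r. norm (if r + t \<le> T then u (r + t) else c) powr q)
      \<longleftrightarrow> integrable ?M (\<lambda>r. norm (v r) powr q)"
    using eq by (intro Bochner_Integration.integrable_cong) auto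
  moreover have "(AE r in ?M. (if r + t \<le> T then u (r + t) else c) \<in> U) \<longleftrightarrow> (AE r in ?M. v r \<in> U)"
    using eq by (intro AE_cong) auto
  ultimately show ?thesis
    unfolding admissible_def mem_Collect_eq by (simp only:)
qed

section \<open>Error estimate for two variation-of-constants formulas\<close>

text \<open>Bridges the Lebesgue integrals of the solution formula and the integral in
  \<open>gronwall_le\<close>. The pointwise bound is almost everywhere because controls lie in
  \<open>U\<close> only almost everywhere.\<close>

lemma norm_set_integral_le:
  fixes f :: "real \<Rightarrow> 'a::{banach, second_countable_topology}"
  assumes f: "set_integrable lebesgue {a..b} f" and g: "continuous_on {a..b} g"
    and le: "AE x in lebesgue. x \<in> {a..b} \<longrightarrow> norm (f x) \<le> g x"
  shows "norm (LINT x:{a..b}|lebesgue. f x) \<le> integral {a..b} g"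
proof -
  have gi: "set_integrable lebesgue {a..b} g"
    using absolutely_integrable_continuous_real[OF g] .
  have "norm (LINT x:{a..b}|lebesgue. f x) \<le> (\<integral>x. norm (indicator {a..b} x *\<^sub>R f x) \<partial>lebesgue)"
    unfolding set_lebesgue_integral_def by (rule integral_norm_bound)
  also have "\<dots> \<le> (LINT x:{a..b}|lebesgue. g x)"
    unfolding set_lebesgue_integral_def
  proof (rule integral_mono_AE)
    show "AE x in lebesgue. norm (indicat_real {a..b} x *\<^sub>R f x) \<le> indicat_real {a..b} x *\<^sub>R g x"
      using le by eventually_elim (auto simp: indicator_def)
  qed (use f gi in \<open>simp_all add: set_integrable_def integrable_norm del: norm_scaleR\<close>)
  also have "\<dots> = integral {a..b} g" by (rule set_lebesgue_integral_eq_integral(2)[OF gi])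
  finally show ?thesis .
qed

text \<open>Subtracting the formulas, \<epsilon> enters once from the initial state and once under
  each of the two integrals, whence \<open>\<epsilon> * (1 + 2 * T)\<close>; the other constants are
  those of \<open>gronwall_le\<close>. In \<open>control\<close> the exceptional null set is the
  same for all \<tau>, since \<tau> becomes \<open>t - r\<close> with varying
  \<open>t\<close>.\<close>

lemma voc_solution_error_le:
  fixes y y' :: "real \<Rightarrow> 'h::{banach, second_countable_topology}"
  assumes y: "voc_solution E G B 0 T x u y" and y': "voc_solution E' G' B' 0 T x' u y'"
    and b: "b > 0" and \<epsilon>: "\<epsilon> \<ge> 0" and s: "s \<in> {0..T}"
    and init: "\<And>t. t \<in> {0..T} \<Longrightarrow> norm (E' t x' - E t x) \<le> \<epsilon>"
    and nonlin: "\<And>\<tau> r. \<tau> \<in> {0..T} \<Longrightarrow> r \<in> {0..T} \<Longrightarrow>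
      norm (E' \<tau> (G' (y' r)) - E \<tau> (G (y r))) \<le> \<epsilon> + b * norm (y' r - y r)"
    and control: "AE r in lebesgue. r \<in> {0..T} \<longrightarrow>
      (\<forall>\<tau>\<in>{0..T}. norm (E' \<tau> (B' (u r)) - E \<tau> (B (u r))) \<le> \<epsilon>)"
  shows "norm (y' s - y s) \<le> 2 * (\<epsilon> * (1 + 2 * T)) * exp (2 * b * T)"
proof -
  have T: "T \<ge> 0" using s by simp
  define \<delta> where "\<delta> r = norm (y' r - y r)" for r
  have cont: "continuous_on {0..T} \<delta>"
    using y y' unfolding \<delta>_def voc_solution_def by (intro continuous_intros) auto
  have "\<delta> t \<le> \<epsilon> * (1 + 2 * T) + b * integral {0..t} \<delta>" if t: "t \<in> {0..T}" for t
  proof -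
    have cont_t: "continuous_on {0..t} \<delta>" using cont by (rule continuous_on_subset) (use t in auto)
    let ?f = "\<lambda>r. E (t - r) (G (y r))" and ?f' = "\<lambda>r. E' (t - r) (G' (y' r))"
    let ?g = "\<lambda>r. E (t - r) (B (u r))" and ?g' = "\<lambda>r. E' (t - r) (B' (u r))"
    have i: "set_integrable lebesgue {0..t} ?f" "set_integrable lebesgue {0..t} ?g"
      "y t = E (t - 0) x + (LINT r:{0..t}|lebesgue. ?f r) + (LINT r:{0..t}|lebesgue. ?g r)"
      using y t unfolding voc_solution_def by blast+
    have i': "set_integrable lebesgue {0..t} ?f'" "set_integrable lebesgue {0..t} ?g'"
      "y' t = E' (t - 0) x' + (LINT r:{0..t}|lebesgue. ?f' r) + (LINT r:{0..t}|lebesgue. ?g' r)"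
      using y' t unfolding voc_solution_def by blast+
    have "y' t - y t = (E' t x' - E t x) + (LINT r:{0..t}|lebesgue. ?f' r - ?f r)
        + (LINT r:{0..t}|lebesgue. ?g' r - ?g r)"
      using i i' by (simp add: set_integral_diff(2))
    then have "\<delta> t \<le> norm (E' t x' - E t x) + norm (LINT r:{0..t}|lebesgue. ?f' r - ?f r)
        + norm (LINT r:{0..t}|lebesgue. ?g' r - ?g r)"
      unfolding \<delta>_def by (metis (no_types, lifting) norm_triangle_ineq norm_triangle_mono order_refl)
    also have "\<dots> \<le> \<epsilon> + integral {0..t} (\<lambda>r. \<epsilon> + b * \<delta> r) + integral {0..t} (\<lambda>r. \<epsilon>)"
    proof (intro add_mono)
      show "norm (E' t x' - E t x) \<le> \<epsilon>" by (rule init[OF t])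
      show "norm (LINT r:{0..t}|lebesgue. ?f' r - ?f r) \<le> integral {0..t} (\<lambda>r. \<epsilon> + b * \<delta> r)"
        using i i' t nonlin
        by (intro norm_set_integral_le set_integral_diff(1) continuous_intros cont_t AE_I2)
          (auto simp: \<delta>_def)
      show "norm (LINT r:{0..t}|lebesgue. ?g' r - ?g r) \<le> integral {0..t} (\<lambda>r. \<epsilon>)"
      proof (intro norm_set_integral_le set_integral_diff(1) continuous_intros i(2) i'(2))
        show "AE r in lebesgue. r \<in> {0..t} \<longrightarrow> norm (?g' r - ?g r) \<le> \<epsilon>"
          using control by eventually_elim (use t in auto)
      qed
    qed
    also have "\<dots> = \<epsilon> * (1 + 2 * t) + b * integral {0..t} \<delta>"
      using t by (subst integral_add)
        (auto intro!: integrable_continuous_real continuous_intros cont_t simp: algebra_simps)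
    also have "\<dots> \<le> \<epsilon> * (1 + 2 * T) + b * integral {0..t} \<delta>"
      using t \<epsilon> by (intro add_right_mono mult_left_mono) auto
    finally show ?thesis .
  qed
  from gronwall_le[OF cont b T this s]
  have "\<delta> s \<le> 2 * (\<epsilon> * (1 + 2 * T)) * exp (2 * b * s)" using \<epsilon> T by simp
  also have "\<dots> \<le> 2 * (\<epsilon> * (1 + 2 * T)) * exp (2 * b * T)"
    using \<epsilon> T b s by (intro mult_left_mono) auto
  finally show ?thesis by (simp add: \<delta>_def)
qed

section \<open>Uniform convergence over controls and starting times\<close>

theorem corollary2p1:
  fixes F :: "'h \<Rightarrow> 'h::{real_inner, banach, second_countable_topology}"
    and C :: "'v::{real_inner, banach, second_countable_topology} \<Rightarrow> 'h"
    and S :: "real \<Rightarrow> 'h \<Rightarrow>\<^sub>L 'h"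
    and D :: "'h set" and L :: "'h \<Rightarrow> 'h"
    and M \<omega> q :: real
    and H :: "nat \<Rightarrow> 'h set" and P :: "nat \<Rightarrow> 'h \<Rightarrow> 'h"
    and SN :: "nat \<Rightarrow> real \<Rightarrow> 'h \<Rightarrow>\<^sub>L 'h"
    and U :: "'v set"
  assumes "C 0 = 0"
    and "c0_semigroup S" and "is_generator S D L"
    and "M \<ge> 1" and "\<omega> \<ge> 0" and "\<forall>t\<ge>0. norm (S t) \<le> M * exp (\<omega> * t)"
    and "\<forall>N\<ge>1. \<exists>B. finite B \<and> H N = span B"
    and "\<forall>N\<ge>1. H N \<subseteq> D"
    and "\<forall>N\<ge>1. is_orthogonal_projector (H N) (P N)"
    and "\<forall>x. (\<lambda>N. norm (P N x - x)) \<longlonglongrightarrow> 0"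
    and "q \<ge> 1" and "compact U"
    and a: "\<forall>N\<ge>1. c0_semigroup (SN N) \<and>
              (\<forall>t\<ge>0. \<forall>x\<in>H N. SN N t x = exp_flow (galerkin_op (P N) L) t x) \<and>
              (\<forall>t\<ge>0. norm (SN N t) \<le> M * exp (\<omega> * t))"
    and b: "\<forall>\<phi>\<in>D. (\<lambda>N. norm (galerkin_op (P N) L \<phi> - L \<phi>)) \<longlonglongrightarrow> 0"
    and c: "lipschitz_on_balls F"
    and d_unique: "\<forall>T>0. \<forall>x. \<forall>u\<in>admissible q U T.
              (\<exists>!y. is_mild_solution S F C 0 T x u y) \<and>
              (\<forall>N\<ge>1. \<exists>!y. is_galerkin_solution (P N) L F C 0 T x u y)"
    and d_bound: "\<forall>T>0. \<forall>x. \<exists>K. \<forall>u\<in>admissible q U T. \<forall>t\<in>{0..T}.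
              norm (mild_sol S F C 0 T x u t) \<le> K \<and>
              (\<forall>N\<ge>1. norm (galerkin_sol (P N) L F C 0 T x u t) \<le> K)"
    and e: "\<forall>T>0. \<forall>x.
              (\<lambda>N. SUP u\<in>admissible q U T. SUP t\<in>{0..T}.
                 ennreal (norm (mild_sol S F C 0 T x u t - P N (mild_sol S F C 0 T x u t)))) \<longlonglongrightarrow> 0"
    and f: "continuous_on UNIV C"
  shows "\<forall>T>0. \<forall>x.
              (\<lambda>N. SUP t\<in>{0..T}. SUP u\<in>admissible_from q U t T. SUP s\<in>{t..T}.
                 ennreal (norm (galerkin_sol (P N) L F C t T x u s - mild_sol S F C t T x u s)))
              \<longlonglongrightarrow> 0"
proof (intro allI impI)
  fix T :: real and x :: 'h assume T: "T > 0"
  interpret galerkin_scheme S M \<omega> D L H P SN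
    by unfold_locales (use assms(2-10) a b in auto)
  let ?y = "mild_sol S F C 0 T x" and ?yN = "\<lambda>N. galerkin_sol (P N) L F C 0 T x"
  let ?ad = "admissible q U T"
  have unique: "\<exists>!y. is_mild_solution S F C 0 T' x u y"
    and unique_N: "N \<ge> 1 \<Longrightarrow> \<exists>!y. is_galerkin_solution (P N) L F C 0 T' x u y"
    if "T' > 0" "u \<in> admissible q U T'" for T' u N
  proof -
    note ex1 = d_unique[THEN spec, THEN mp, OF that(1), THEN spec, THEN bspec, OF that(2)]
    show "\<exists>!y. is_mild_solution S F C 0 T' x u y" by (rule conjunct1[OF ex1])
    show "\<exists>!y. is_galerkin_solution (P N) L F C 0 T' x u y" if "N \<ge> 1"
      by (rule conjunct2[OF ex1, THEN spec, THEN mp, OF that])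
  qed
  define Y where "Y = {?y u t | u t. u \<in> ?ad \<and> t \<in> {0..T}}"
  obtain K0 where K0: "\<And>u t. u \<in> ?ad \<Longrightarrow> t \<in> {0..T} \<Longrightarrow> norm (?y u t) \<le> K0"
    "\<And>u t N. u \<in> ?ad \<Longrightarrow> t \<in> {0..T} \<Longrightarrow> N \<ge> 1 \<Longrightarrow> norm (?yN N u t) \<le> K0"
    using d_bound T by meson
  \<comment> \<open>The extra 1 puts the states, and even the closure of \<open>Y\<close>, into an
    open ball on which \<open>F\<close> is Lipschitz.\<close>
  define R where "R = \<bar>K0\<bar> + 1"
  have "R > 0" by (simp add: R_def)
  then obtain l where l: "l-lipschitz_on (ball 0 R) F"
    using c by (auto simp: lipschitz_on_balls_def)
  have in_ball: "?y u t \<in> ball 0 R" "N \<ge> 1 \<Longrightarrow> ?yN N u t \<in> ball 0 R"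
    if "u \<in> ?ad" "t \<in> {0..T}" for u t N
    using K0(1)[OF that] K0(2)[OF that, of N] by (auto simp: R_def)
  have Y_compact: "compact (closure Y)"
  proof (rule compact_closure_if_nearly_compact)
    fix \<epsilon> :: real assume "\<epsilon> > 0"
    then have "\<forall>\<^sub>F N in sequentially.
        (SUP u\<in>?ad. SUP t\<in>{0..T}. ennreal (norm (?y u t - P N (?y u t)))) < ennreal \<epsilon>"
      using e T by (intro order_tendstoD(2)[where y = 0]) auto
    then have "\<forall>\<^sub>F N in sequentially. N \<ge> 1 \<and>
        (SUP u\<in>?ad. SUP t\<in>{0..T}. ennreal (norm (?y u t - P N (?y u t)))) < ennreal \<epsilon>"
      using eventually_ge_at_top[of 1] by eventually_elim simp
    then obtain N where N: "N \<ge> 1"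
      "(SUP u\<in>?ad. SUP t\<in>{0..T}. ennreal (norm (?y u t - P N (?y u t)))) < ennreal \<epsilon>"
      by (auto simp: eventually_sequentially)
    obtain B where "finite B" "H N = span B" using finite_dim[OF N(1)] by blast
    then obtain X where X: "compact X" "P N ` cball 0 R \<subseteq> X"
      using orthogonal_projector_bounded_image_compact[of B "P N" R] projector[OF N(1)] by auto
    have "\<exists>z\<in>X. dist y z < \<epsilon>" if y: "y \<in> Y" for y
    proof -
      obtain u t where ut: "u \<in> ?ad" "t \<in> {0..T}" "y = ?y u t" using y by (auto simp: Y_def)
      have "ennreal (norm (y - P N y)) \<le> (SUP t\<in>{0..T}. ennreal (norm (?y u t - P N (?y u t))))"
        unfolding ut(3) using ut(2) by (rule SUP_upper)
      also have "\<dots> \<le> (SUP u\<in>?ad. SUP t\<in>{0..T}. ennreal (norm (?y u t - P N (?y u t))))"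
        using ut(1) by (rule SUP_upper)
      also have "\<dots> < ennreal \<epsilon>" by (rule N(2))
      finally have "norm (y - P N y) < \<epsilon>" using \<open>\<epsilon> > 0\<close> by (simp add: ennreal_less_iff)
      moreover have "y \<in> cball 0 R" using in_ball(1)[OF ut(1,2)] ut(3) by simp
      then have "P N y \<in> X" using X(2) by blast
      ultimately show ?thesis by (auto simp: dist_norm)
    qed
    with X(1) show "\<exists>X. compact X \<and> (\<forall>y\<in>Y. \<exists>z\<in>X. dist y z < \<epsilon>)" by blast
  qed
  have "Y \<subseteq> cball 0 \<bar>K0\<bar>" using K0(1) by (fastforce simp: Y_def)
  then have "closure Y \<subseteq> cball 0 \<bar>K0\<bar>" by (rule closure_minimal) simp
  also have "\<dots> \<subseteq> ball 0 R" by (auto simp: R_def)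
  finally have "continuous_on (closure Y) F"
    using lipschitz_on_continuous_on[OF l] continuous_on_subset by blast
  then have "compact (F ` closure Y)" using Y_compact by (rule compact_continuous_image)
  moreover have "compact (C ` U)"
    using f \<open>compact U\<close> continuous_on_subset by (blast intro: compact_continuous_image)
  \<comment> \<open>One compact set for the three terms of the formula: initial state, nonlinearity
    along the exact states, control.\<close>
  ultimately have X: "compact (insert x (F ` closure Y \<union> C ` U))"
    by (intro compact_insert compact_Un)
  have main: "\<forall>\<^sub>F N in sequentially. N \<ge> 1 \<and> (\<forall>u\<in>?ad. \<forall>s\<in>{0..T}. norm (?yN N u s - ?y u s) \<le> \<eta>)"
    if \<eta>: "\<eta> > 0" for \<eta>
  proof -
    \<comment> \<open>The Lipschitz constant of \<open>F\<close> after the flow; the added 1 keeps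
      the rate positive when \<open>l = 0\<close>.\<close>
    define k where "k = growth_bound T * l + 1"
    have l0: "l \<ge> 0" using l by (rule lipschitz_on_nonneg)
    have gb: "growth_bound T \<ge> 1" using growth_bound_ge_1 T by simp
    have k: "k > 0" using l0 gb by (simp add: k_def add_nonneg_pos)
    \<comment> \<open>Solved from the right-hand side of \<open>voc_solution_error_le\<close>, so
      that the final bound is exactly \<eta>.\<close>
    define \<epsilon> where "\<epsilon> = \<eta> / (2 * (1 + 2 * T) * exp (2 * k * T))"
    have \<epsilon>: "\<epsilon> > 0" "2 * (\<epsilon> * (1 + 2 * T)) * exp (2 * k * T) = \<eta>"
      using \<eta> T by (auto simp: \<epsilon>_def divide_simps)
    have "\<forall>\<^sub>F N in sequentially. \<forall>t\<in>{0..T}. \<forall>z\<in>insert x (F ` closure Y \<union> C ` U).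
        norm (SN N t (P N z) - S t z) < \<epsilon>"
      using T by (intro trotter_kato X \<epsilon>(1)) simp
    then show ?thesis using eventually_ge_at_top[of 1]
    proof eventually_elim
      case (elim N)
      have flow: "exp_flow (galerkin_op (P N) L) \<tau> (P N z) = SN N \<tau> (P N z)" if "\<tau> \<ge> 0" for \<tau> z
        using SN_flow[OF elim(2) that projector_in[OF elim(2)]] by simp
      have "norm (?yN N u s - ?y u s) \<le> \<eta>" if u: "u \<in> ?ad" and s: "s \<in> {0..T}" for u s
      proof -
        have "is_mild_solution S F C 0 T x u (?y u)"
          unfolding mild_sol_def by (rule theI'[OF unique[OF T u]])
        then have y: "voc_solution (\<lambda>\<tau>. blinfun_apply (S \<tau>)) F C 0 T x u (?y u)"
          by (simp add: is_mild_solution_def)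
        have "is_galerkin_solution (P N) L F C 0 T x u (?yN N u)"
          unfolding galerkin_sol_def by (rule theI'[OF unique_N[OF T u elim(2)]])
        then have yN: "voc_solution (exp_flow (galerkin_op (P N) L)) (\<lambda>z. P N (F z)) (\<lambda>v. P N (C v))
            0 T (P N x) u (?yN N u)"
          by (simp add: is_galerkin_solution_def)
        show ?thesis
          unfolding \<epsilon>(2)[symmetric]
        proof (rule voc_solution_error_le[OF y yN k less_imp_le[OF \<epsilon>(1)] s])
          show "norm (exp_flow (galerkin_op (P N) L) t (P N x) - S t x) \<le> \<epsilon>" if "t \<in> {0..T}" for t
            using elim(1) that by (auto simp: flow less_imp_le)
          show "AE r in lebesgue. r \<in> {0..T} \<longrightarrow> (\<forall>\<tau>\<in>{0..T}.
              norm (exp_flow (galerkin_op (P N) L) \<tau> (P N (C (u r))) - S \<tau> (C (u r))) \<le> \<epsilon>)"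
            using admissible_AE[OF u]
            by eventually_elim (use elim(1) in \<open>auto simp: flow less_imp_le\<close>)
          fix \<tau> r assume \<tau>: "\<tau> \<in> {0..T}" and r: "r \<in> {0..T}"
          let ?z = "F (?y u r)" and ?z' = "F (?yN N u r)"
          have "?y u r \<in> closure Y" using u r closure_subset by (fastforce simp: Y_def)
          then have 1: "norm (SN N \<tau> (P N ?z) - S \<tau> ?z) \<le> \<epsilon>" using elim(1) \<tau> by (auto intro: less_imp_le)
          have "norm (SN N \<tau> (P N (?z' - ?z))) \<le> growth_bound T * norm (P N (?z' - ?z))"
            using \<tau> by (intro norm_SN_le elim) auto
          also have "\<dots> \<le> growth_bound T * norm (?z' - ?z)"
            using gb norm_projector_le[OF elim(2)] by (intro mult_left_mono) auto
          also have "\<dots> \<le> growth_bound T * (l * norm (?yN N u r - ?y u r))"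
            using gb lipschitz_onD[OF l in_ball(2)[OF u r elim(2)] in_ball(1)[OF u r]]
            by (intro mult_left_mono) (auto simp: dist_norm)
          also have "\<dots> \<le> k * norm (?yN N u r - ?y u r)"
            by (simp add: k_def distrib_right)
          finally have 2: "norm (SN N \<tau> (P N (?z' - ?z))) \<le> k * norm (?yN N u r - ?y u r)" .
          \<comment> \<open>Trotter-Kato is applied only at the exact state, whose image under
            \<open>F\<close> lies in the compact set. The Galerkin states enter through the
            Lipschitz bound alone, so no compactness of theirs is required.\<close>
          have "SN N \<tau> (P N ?z') - S \<tau> ?z = SN N \<tau> (P N (?z' - ?z)) + (SN N \<tau> (P N ?z) - S \<tau> ?z)"
            using bounded_linear_projector[OF elim(2)]
            by (simp add: linear_diff bounded_linear.linear blinfun.diff_right)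
          then have "norm (SN N \<tau> (P N ?z') - S \<tau> ?z)
              \<le> norm (SN N \<tau> (P N (?z' - ?z))) + norm (SN N \<tau> (P N ?z) - S \<tau> ?z)"
            by (metis norm_triangle_ineq)
          also have "\<dots> \<le> k * norm (?yN N u r - ?y u r) + \<epsilon>" by (rule add_mono[OF 2 1])
          finally show "norm (exp_flow (galerkin_op (P N) L) \<tau> (P N ?z') - S \<tau> ?z)
              \<le> \<epsilon> + k * norm (?yN N u r - ?y u r)"
            using \<tau> flow[of \<tau> ?z'] by simp
        qed
      qed
      with elim(2) show ?case by blast
    qed
  qed
  show "(\<lambda>N. SUP t\<in>{0..T}. SUP u\<in>admissible_from q U t T. SUP s\<in>{t..T}.
      ennreal (norm (galerkin_sol (P N) L F C t T x u s - mild_sol S F C t T x u s))) \<longlonglongrightarrow> 0"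
  proof (rule tendsto_zero_ennreal)
    fix \<eta> :: real assume \<eta>: "\<eta> > 0"
    \<comment> \<open>Suprema preserve only the weak inequality; half of \<eta> leaves room for the
      strict one.\<close>
    then have "\<eta> / 2 > 0" by simp
    from main[OF this] show "\<forall>\<^sub>F N in sequentially.
        (SUP t\<in>{0..T}. SUP u\<in>admissible_from q U t T. SUP s\<in>{t..T}.
          ennreal (norm (galerkin_sol (P N) L F C t T x u s - mild_sol S F C t T x u s))) < ennreal \<eta>"
    proof eventually_elim
      case (elim N)
      have "norm (galerkin_sol (P N) L F C t T x w s - mild_sol S F C t T x w s) \<le> \<eta> / 2"
        if t: "t \<in> {0..T}" and w: "w \<in> admissible_from q U t T" and s: "s \<in> {t..T}" for t w s
      proof -
        obtain u where u: "u \<in> ?ad" "w = restrict u {t..T}"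
          using w by (auto simp: admissible_from_def)
        obtain z where z: "z \<in> U" using admissible_imp_nonempty[OF u(1) T] by blast
        \<comment> \<open>The shifted control, filled with \<open>z\<close> after
          \<open>T - t\<close>. It is admissible on the horizon \<open>T\<close>, where
          \<open>main\<close> applies, and on \<open>T - t\<close>, where uniqueness is
          needed.\<close>
        define v where "v r = (if r + t \<le> T then u (r + t) else z)" for r
        have v: "v \<in> admissible q U T'" for T'
          using admissible_translate[OF u(1) compact_imp_bounded[OF \<open>compact U\<close>] z, of t T'] t \<open>q \<ge> 1\<close>
          by (simp add: v_def[abs_def])
        have wv: "w r = v (r - t)" if "r \<in> {t..T}" for r
          using that by (simp add: u(2) v_def)
        have t': "0 \<le> t" "t \<le> T" using t by auto
        have "mild_sol S F C t T x w s = ?y v (s - t)"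
          unfolding mild_sol_def is_mild_solution_def
        proof (rule the_voc_solution_translate[where w = w and v = v, OF t' wv _ _ s])
          show "\<exists>!y. voc_solution (\<lambda>\<tau>. blinfun_apply (S \<tau>)) F C 0 T x v y"
            using unique[OF T v] unfolding is_mild_solution_def .
          show "\<exists>!y. voc_solution (\<lambda>\<tau>. blinfun_apply (S \<tau>)) F C 0 (T - t) x v y" if "t < T"
            using unique[OF _ v, of "T - t"] that unfolding is_mild_solution_def by simp
        qed
        moreover have "galerkin_sol (P N) L F C t T x w s = ?yN N v (s - t)"
          unfolding galerkin_sol_def is_galerkin_solution_def
        proof (rule the_voc_solution_translate[where w = w and v = v, OF t' wv _ _ s])
          have N: "N \<ge> 1" using elim by simp
          show "\<exists>!y. voc_solution (exp_flow (galerkin_op (P N) L)) (\<lambda>z. P N (F z)) (\<lambda>v. P N (C v))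
              0 T (P N x) v y"
            using unique_N[OF T v N] unfolding is_galerkin_solution_def .
          show "\<exists>!y. voc_solution (exp_flow (galerkin_op (P N) L)) (\<lambda>z. P N (F z)) (\<lambda>v. P N (C v))
              0 (T - t) (P N x) v y" if "t < T"
            using unique_N[OF _ v N, of "T - t"] that unfolding is_galerkin_solution_def by simp
        qed
        ultimately show ?thesis using elim v s t' by simp
      qed
      then have "(SUP t\<in>{0..T}. SUP u\<in>admissible_from q U t T. SUP s\<in>{t..T}.
          ennreal (norm (galerkin_sol (P N) L F C t T x u s - mild_sol S F C t T x u s))) \<le> ennreal (\<eta> / 2)"
        by (intro SUP_least ennreal_leI) auto
      also have "\<dots> < ennreal \<eta>" using \<eta> by (simp add: ennreal_less_iff)
      finally show ?case .
    qed
  qed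
qed

end
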